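(* Let $0<\nu<1$, $T>0$, $\lambda>0$, $y_0\in\mathbb{R}$, let $N$ be a positive integer, and $\Delta x = T/(2N)$. Let $y_1,\dots,y_{2N}$ be the numerical solution of the scheme ${}_0D_{\Delta x}^{\nu} y_j = -\lambda y_j$, $j=1,\dots,2N$ (i.e. the scheme ${}_0D_{\Delta x}^{\nu} y_j = f(x_j,y_j)$ with $f(x,y)=-\lambda y$), with initial value $y_0$. Then the scheme is stable in the sense that $$|y_k|\le \frac{2+\nu}{2-\nu}\,|y_0|\qquad\text{for all } k=1,\dots,2N.$$
   Context: Grid: $x_j=j\Delta x$, $j=0,1,\dots,2N$, with $\Delta x=T/(2N)$. Kernel: $\omega_{1-\nu}(x)=x^{-\nu}/\Gamma(1-\nu)$. Discrete Caputo derivative. For grid values $z_0,\dots,z_{2N}$, let $I_{[x_i,x_{i+2}]}z$ be the polynomial of degree at most 2 taking the values $z_i,z_{i+1},z_{i+2}$ at $x_i,x_{i+1},x_{i+2}$. Define the piecewise quadratic function $\Pi_j z$ on $[0,x_j]$ by: - for $j=1,2$: $\Pi_j z=I_{[x_0,x_2]}z$ on $[0,x_j]$; - for $j=2m+1$, $1\le m\le N-1$: $\Pi_jz=I_{[x_0,x_2]}z$ on $[x_0,x_1]$ and $\Pi_jz=I_{[x_{2k-1},x_{2k+1}]}z$ on $[x_{2k-1},x_{2k+1}]$ for $k=1,\dots,m$; - for $j=2m+2$, $1\le m\le N-1$: $\Pi_jz=I_{[x_{2k},x_{2k+2}]}z$ on $[x_{2k},x_{2k+2}]$ for $k=0,\dots,m$.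 Then ${}_0D_{\Delta x}^{\nu}z_j=\int_0^{x_j}(\Pi_jz)'(s)\,\omega_{1-\nu}(x_j-s)\,ds$ for $j=1,\dots,2N$ (derivative taken piecewise). Note that ${}_0D_{\Delta x}^{\nu}z_1$ involves $z_2$, so $y_1,y_2$ are determined simultaneously by the scheme. *)

theory Defs
  imports "HOL-Analysis.Analysis" "HOL-Computational_Algebra.Polynomial"
begin

definition grid :: "real \<Rightarrow> nat \<Rightarrow> real" where
  "grid h j = real j * h"

definition omega :: "real \<Rightarrow> real \<Rightarrow> real" where
  "omega \<nu> x = x powr (- \<nu>) / Gamma (1 - \<nu>)"  (* the kernel with subscript 1 - \<nu> *)

definition interp :: "real \<Rightarrow> (nat \<Rightarrow> real) \<Rightarrow> nat \<Rightarrow> real poly" where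
  "interp h z i = (THE p. degree p \<le> 2 \<and> (\<forall>k\<in>{i, i + 1, i + 2}. poly p (grid h k) = z k))"

(* piece_start h j s is the left index i of the stencil {i, i + 1, i + 2} used at the point s.
   LEAST selects the piece (x_i, x_(i+2)] containing s; neighbouring pieces agree at their common
   node, so the choice of the half-open side is immaterial.  For odd j the case s > x_1 forces
   k >= 1.  Only 0 <= s <= x_j is meaningful. *)
definition piece_start :: "real \<Rightarrow> nat \<Rightarrow> real \<Rightarrow> nat" where
  "piece_start h j s =
     (if j \<le> 2 then 0
      else if odd j then
        (if s \<le> grid h 1 then 0 else 2 * (LEAST k. s \<le> grid h (2 * k + 1)) - 1)
      else 2 * (LEAST k. s \<le> grid h (2 * k + 2)))"

definition pw_quad :: "real \<Rightarrow> nat \<Rightarrow> (nat \<Rightarrow> real) \<Rightarrow> real \<Rightarrow> real" where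
  "pw_quad h j z s = poly (interp h z (piece_start h j s)) s"

(* pw_quad may fail to be differentiable at the finitely many grid points; the value that deriv
   takes there does not affect the integral. *)
definition discrete_caputo :: "real \<Rightarrow> real \<Rightarrow> (nat \<Rightarrow> real) \<Rightarrow> nat \<Rightarrow> real" where
  "discrete_caputo \<nu> h z j =
     integral {0..grid h j} (\<lambda>s. deriv (pw_quad h j z) s * omega \<nu> (grid h j - s))"

lemma interp_ex1:
  assumes "h > 0"
  shows "\<exists>!p. degree p \<le> 2 \<and> (\<forall>k\<in>{i, i + 1, i + 2}. poly p (grid h k) = z k)"
proof (rule ex_ex1I)
  define a where "a = grid h i"
  have g: "grid h i = a" "grid h (i + 1) = a + h" "grid h (i + 2) = a + 2 * h"
    by (simp_all add: a_def grid_def algebra_simps)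
  define d where "d = (z (i + 1) - z i) / h"
  define e where "e = (z (i + 2) - 2 * z (i + 1) + z i) / (2 * h ^ 2)"
  define p where "p = [:z i - d * a + e * a * (a + h), d - e * (2 * a + h), e:]"
  have p: "poly p s = z i + d * (s - a) + e * (s - a) * (s - (a + h))" for s
    by (simp add: p_def algebra_simps)
  have e: "e * h * h = (z (i + 2) - 2 * z (i + 1) + z i) / 2" "d * h = z (i + 1) - z i"
    using assms by (simp_all add: e_def d_def power2_eq_square)
  have "poly p a = z i" "poly p (a + h) = z (i + 1)"
    using e by (simp_all add: p)
  moreover have "poly p (a + 2 * h) = z i + 2 * (d * h) + 2 * (e * h * h)"
    by (simp add: p algebra_simps)
  hence "poly p (a + 2 * h) = z (i + 2)"
    using e by (simp add: field_simps)
  moreover have "degree p \<le> 2"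
    by (simp add: p_def)
  ultimately show "\<exists>p. degree p \<le> 2 \<and> (\<forall>k\<in>{i, i + 1, i + 2}. poly p (grid h k) = z k)"
    using g by (intro exI[of _ p]) auto
next
  fix p q
  assume p: "degree p \<le> 2 \<and> (\<forall>k\<in>{i, i + 1, i + 2}. poly p (grid h k) = z k)"
    and q: "degree q \<le> 2 \<and> (\<forall>k\<in>{i, i + 1, i + 2}. poly q (grid h k) = z k)"
  have inj: "inj (grid h)"
    using assms by (auto simp: inj_on_def grid_def)
  have "card (grid h ` {i, i + 1, i + 2}) = 3"
    by (subst card_image[OF inj_on_subset[OF inj]]) auto
  moreover have "poly p s = poly q s" if "s \<in> grid h ` {i, i + 1, i + 2}" for s
    using p q that by auto
  ultimately show "p = q"
    using p q by (intro poly_eqI_degree[of "grid h ` {i, i + 1, i + 2}"]) auto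
qed

lemma piece_start_even:
  assumes "h > 0" "even j" "j > 2" "grid h (2 * k) < s" "s \<le> grid h (2 * k + 2)"
  shows "piece_start h j s = 2 * k"
proof -
  have "(LEAST m. s \<le> grid h (2 * m + 2)) = k"
  proof (rule Least_equality)
    fix m assume "s \<le> grid h (2 * m + 2)"
    hence "real (2 * k) * h < real (2 * m + 2) * h"
      using assms(4) by (simp add: grid_def)
    hence "2 * k < 2 * m + 2"
      using assms(1) by (simp only: mult_less_cancel_right_pos of_nat_less_iff)
    thus "k \<le> m" by simp
  qed (use assms in simp)
  thus ?thesis using assms(2,3) by (simp add: piece_start_def)
qed

lemma piece_start_odd:
  assumes "h > 0" "odd j" "j > 2" "k \<ge> 1" "grid h (2 * k - 1) < s" "s \<le> grid h (2 * k + 1)"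
  shows "piece_start h j s = 2 * k - 1"
proof -
  have "(LEAST m. s \<le> grid h (2 * m + 1)) = k"
  proof (rule Least_equality)
    fix m assume "s \<le> grid h (2 * m + 1)"
    hence "real (2 * k - 1) * h < real (2 * m + 1) * h"
      using assms(5) by (simp only: grid_def)
    hence "2 * k - 1 < 2 * m + 1"
      using assms(1) by (simp only: mult_less_cancel_right_pos of_nat_less_iff)
    thus "k \<le> m" using assms(4) by simp
  qed (use assms in simp)
  moreover have "grid h 1 \<le> grid h (2 * k - 1)"
    using assms(1,4) unfolding grid_def by (intro mult_right_mono) auto
  ultimately show ?thesis using assms(2,3,5) by (simp add: piece_start_def)
qed

end

theory Submission
  imports Defs
begin

text \<open>Put \<open>\<eta> = 2\<nu> / (2 + \<nu>)\<close>; minus twice this number is the quotient of the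
  second and the leading weight of the scheme.  Written in terms of the differences
  \<open>y k - \<eta> * y (k - 1)\<close>, the scheme has a positive leading coefficient, all its other
  coefficients are nonpositive, and they sum to at most the leading one in absolute value
  (for \<open>j \<ge> 2\<close>; the value at \<open>j = 1\<close> comes from solving the first two equations).
  Testing with the difference itself gives by induction an energy bound, in particular
  \<open>\<bar>y k - \<eta> * y (k - 1)\<bar> \<le> \<bar>y0\<bar>\<close>, and the geometric series yields the factor
  \<open>1 / (1 - \<eta>) = (2 + \<nu>) / (2 - \<nu>)\<close>.\<close>

text \<open>The original weights lack the sign pattern of a maximum principle. As \<nu> tends to 1,
  the weights for l = 0, 1, 2 become proportional to 3, -4, 1, as in the two-step backward
  difference formula, and the positive third one blocks a direct induction on the absolute values.
  Dividing the generating function by 1 - x z turns the third coefficient into W 2 + x * W 1 + x^2 *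
  W 0, which is smallest at x = - W 1 / (2 * W 0); this is \<eta>. A quadratic energy is needed
  because the right-hand side contains \<open>y j\<close> itself and not the difference. The signs
  are delicate at short distance from the evaluation point, where the kernel varies fast, and at the
  left end for odd j: there a half stencil overlaps a full one and perturbs three weights. For j = 3
  these are all the weights after the leading one.\<close>

section \<open>Elementary inequalities for negative powers and a comparison integral\<close>

lemma powr_uminus_ge:
  fixes y p :: real
  assumes "y > 0" "0 \<le> p"
  shows "1 + p * (1 - y) \<le> y powr (-p)"
proof -
  have "p * ln y \<le> p * (y - 1)"
    using assms by (intro mult_left_mono ln_le_minus_one) auto
  moreover have "1 + (-p * ln y) \<le> exp (-p * ln y)"
    by (rule exp_ge_add_one_self)
  ultimately show ?thesis
    using assms(1) by (simp add: powr_def algebra_simps)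
qed

text \<open>Tangent line at 1 in the variable 1 / y, where the power is concave;
  \<open>powr_uminus_ge\<close> is the tangent in y, where it is convex. After rescaling, this pair
  supplies the kernel bounds below.\<close>

lemma powr_uminus_le:
  fixes y p :: real
  assumes "y > 0" "0 \<le> p" "p \<le> 1"
  shows "y powr (-p) \<le> 1 + p * (1 - y) / y"
proof -
  have "(1 / y) powr p * 1 powr (1 - p) \<le> p * (1 / y) + (1 - p) * 1"
    using assms by (intro Youngs_inequality_0) auto
  moreover have "(1 / y) powr p = y powr (-p)"
    using assms(1) by (simp add: powr_divide powr_minus_divide)
  ultimately show ?thesis
    using assms(1) by (simp add: field_simps)
qed

lemma powr_uminus_scale:
  fixes c x p :: real
  assumes "c > 0" "x > 0"
  shows "x powr (-p) = c powr (-p) * (x / c) powr (-p)"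
  using assms by (simp add: powr_divide)

lemma has_integral_quadratic:
  fixes a b c u :: real
  assumes "u \<ge> 0"
  shows "((\<lambda>r. a + b * r + c * r\<^sup>2) has_integral (a * u + b * u\<^sup>2 / 2 + c * u ^ 3 / 3)) {0..u}"
proof -
  have "((\<lambda>r. a + b * r + c * r\<^sup>2) has_integral
      (a * u + b * u\<^sup>2 / 2 + c * u ^ 3 / 3 - (a * 0 + b * 0\<^sup>2 / 2 + c * 0 ^ 3 / 3))) {0..u}"
    using assms
    by (intro fundamental_theorem_of_calculus)
       (auto simp flip: has_real_derivative_iff_has_vector_derivative simp: power2_eq_square
             intro!: derivative_eq_intros)
  thus ?thesis by simp
qed

text \<open>The constant 2 is sharp for this argument: \<open>r - 3/2 \<le> r ^ 4 / 32\<close>, and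
  \<open>\<integral>r (3/2 - r) dr\<close> and \<open>\<integral>r ^ 5 / 32 dr\<close> over \<open>[0, 2]\<close> both equal \<open>1/3\<close>.\<close>

lemma integral_three_halves_minus_nonneg:
  fixes G :: "real \<Rightarrow> real"
  assumes "a \<ge> 0"
    and lower: "\<And>r. 0 \<le> r \<Longrightarrow> r < 2 \<Longrightarrow> a * r \<le> G r"
    and upper: "\<And>r. 0 \<le> r \<Longrightarrow> r < 2 \<Longrightarrow> G r \<le> 2 * a * r"
    and int: "((\<lambda>r. (3 / 2 - r) * G r) has_integral I) {0..2}"
  shows "I \<ge> 0"
proof -
  let ?g = "\<lambda>r. a * (3 / 2 * r - r\<^sup>2 - r ^ 5 / 32)"
  let ?F = "\<lambda>r. a * (3 / 4 * r\<^sup>2 - r ^ 3 / 3 - r ^ 6 / 192)"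
  have "(?g has_integral (?F 2 - ?F 0)) {0..2}"
    by (intro fundamental_theorem_of_calculus)
       (auto simp flip: has_real_derivative_iff_has_vector_derivative simp: power2_eq_square
             algebra_simps intro!: derivative_eq_intros)
  moreover have "?F 2 - ?F 0 = 0" by simp
  ultimately have g: "(?g has_integral 0) {0..2}" by simp
  have le: "?g r \<le> (3 / 2 - r) * G r" if r: "0 \<le> r" "r < 2" for r
  proof (cases "r \<le> 3 / 2")
    case True
    have "?g r \<le> (3 / 2 - r) * (a * r)"
      using assms(1) r by (simp add: algebra_simps power2_eq_square)
    also have "\<dots> \<le> (3 / 2 - r) * G r"
      using True lower[OF r] by (intro mult_left_mono) auto
    finally show ?thesis .
  next
    case False
    \<comment> \<open>The product expands to r^4 - 32 r + 48. The factor 1/32 is the one for which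
      the quartic is tangent to the line r - 3/2; they touch at r = 2.\<close>
    have "0 \<le> (r - 2)\<^sup>2 * (r\<^sup>2 + 4 * r + 12)"
      using r by (intro mult_nonneg_nonneg) auto
    hence "r - 3 / 2 \<le> r ^ 4 / 32"
      by (simp add: algebra_simps power2_eq_square power4_eq_xxxx)
    hence "(a * r) * (r - 3 / 2) \<le> (a * r) * (r ^ 4 / 32)"
      using assms(1) r by (intro mult_left_mono) auto
    moreover have "r ^ 5 = r * r ^ 4"
      by (simp add: numeral_eq_Suc)
    ultimately have "?g r \<le> (3 / 2 - r) * (2 * a * r)"
      by (simp add: algebra_simps power2_eq_square)
    also have "\<dots> \<le> (3 / 2 - r) * G r"
      using False upper[OF r] by (intro mult_left_mono_neg) auto
    finally show ?thesis .
  qed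
  \<comment> \<open>The bounds on \<open>G\<close> stop short of r = 2, so the value there is
    replaced by that of the minorant.\<close>
  have "((\<lambda>r. if r = 2 then ?g 2 else (3 / 2 - r) * G r) has_integral I) {0..2}"
    by (rule has_integral_spike_finite[OF _ _ int, of "{2}"]) auto
  from has_integral_le[OF g this] show ?thesis
    using le by fastforce
qed

section \<open>Integrals of linear functions against the kernel\<close>

text \<open>In units of the step, r is measured from the left end of a stencil and D is the distance
  from there to the evaluation point. The pairs (p, q) = (1, -3/2), (-2, 2), (1, -1/2) used
  throughout are the derivatives of the Lagrange basis at the nodes 0, 1, 2.\<close>

definition kint :: "real \<Rightarrow> real \<Rightarrow> real \<Rightarrow> real \<Rightarrow> real \<Rightarrow> real" where
  "kint \<nu> b p q D = integral {0..b} (\<lambda>r. (p * r + q) * (D - r) powr (-\<nu>))"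

context
  fixes \<nu> :: real
  assumes nu: "0 < \<nu>" "\<nu> < 1"
begin

lemma has_integral_kint_closed:
  assumes "0 \<le> b" "b \<le> D"
  shows "((\<lambda>r. (p * r + q) * (D - r) powr (-\<nu>)) has_integral
    ((p * D + q) * (D powr (1 - \<nu>) - (D - b) powr (1 - \<nu>)) / (1 - \<nu>)
     - p * (D powr (2 - \<nu>) - (D - b) powr (2 - \<nu>)) / (2 - \<nu>))) {0..b}"
proof -
  let ?F = "\<lambda>r. p * (D - r) powr (2 - \<nu>) / (2 - \<nu>) - (p * D + q) * (D - r) powr (1 - \<nu>) / (1 - \<nu>)"
  have "((\<lambda>r. (p * r + q) * (D - r) powr (-\<nu>)) has_integral (?F b - ?F 0)) {0..b}"
  \<comment> \<open>For b = D the integrand is singular at the right end, but the antiderivative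
    stays continuous there because 1 - \<nu> > 0.\<close>
  proof (rule fundamental_theorem_of_calculus_interior)
    show "continuous_on {0..b} ?F"
      using assms nu by (intro continuous_intros continuous_on_powr') auto
    fix r assume r: "r \<in> {0<..<b}"
    hence pos: "D - r > 0" using assms by auto
    have "(D - r) powr (1 - \<nu>) = (D - r) * (D - r) powr (-\<nu>)"
      using pos powr_mult_base[of "D - r" "-\<nu>"] by simp
    hence e: "(p * r + q) * (D - r) powr (-\<nu>) = 
        (p * D + q) * (D - r) powr (-\<nu>) - p * (D - r) powr (1 - \<nu>)"
      by (simp only:) (simp add: algebra_simps)
    have "(?F has_real_derivative
        (p * D + q) * (D - r) powr (-\<nu>) - p * (D - r) powr (1 - \<nu>)) (at r)"
      using pos nu by (auto intro!: derivative_eq_intros)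
    thus "(?F has_vector_derivative (p * r + q) * (D - r) powr (-\<nu>)) (at r)"
      by (simp only: e flip: has_real_derivative_iff_has_vector_derivative)
  qed (use assms in auto)
  moreover have "?F b - ?F 0 = (p * D + q) * (D powr (1 - \<nu>) - (D - b) powr (1 - \<nu>)) / (1 - \<nu>)
     - p * (D powr (2 - \<nu>) - (D - b) powr (2 - \<nu>)) / (2 - \<nu>)"
    by (simp add: right_diff_distrib diff_divide_distrib)
  ultimately show ?thesis by simp
qed

lemma kint_closed:
  assumes "0 \<le> b" "b \<le> D"
  shows "kint \<nu> b p q D =
    (p * D + q) * (D powr (1 - \<nu>) - (D - b) powr (1 - \<nu>)) / (1 - \<nu>)
     - p * (D powr (2 - \<nu>) - (D - b) powr (2 - \<nu>)) / (2 - \<nu>)"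
  unfolding kint_def by (rule integral_unique[OF has_integral_kint_closed[OF assms]])

lemma has_integral_kint:
  assumes "0 \<le> b" "b \<le> D"
  shows "((\<lambda>r. (p * r + q) * (D - r) powr (-\<nu>)) has_integral kint \<nu> b p q D) {0..b}"
  unfolding kint_def
  using has_integral_kint_closed[OF assms] by (rule integrable_integral[OF has_integral_integrable])

text \<open>The substitution r to 2 - r gives the right-node integral the same factor 3/2 - r as the
  negated left-node integral, so that the two can be combined under one integral sign.\<close>

lemma has_integral_kint_reflected:
  assumes "D \<ge> 2"
  shows "((\<lambda>r. (3 / 2 - r) * (D - 2 + r) powr (-\<nu>)) has_integral kint \<nu> 2 1 (-1 / 2) D) {0..2}"
proof -
  have "((\<lambda>r. (1 * r + -1 / 2) * (D - r) powr (-\<nu>)) has_integral kint \<nu> 2 1 (-1 / 2) D) (cbox 0 2)"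
    using assms has_integral_kint[of 2 D 1 "-1 / 2"] by simp
  from has_integral_affinity[OF this, of "-1" 2] show ?thesis
    by (simp add: algebra_simps)
qed

lemma kint_linear_combination:
  assumes "0 \<le> b" "b \<le> D"
  shows "kint \<nu> b (u * p + v * p' + w * p'') (u * q + v * q' + w * q'') D =
    u * kint \<nu> b p q D + v * kint \<nu> b p' q' D + w * kint \<nu> b p'' q'' D"
  using assms by (simp add: kint_closed algebra_simps add_divide_distrib diff_divide_distrib)

text \<open>The Lagrange basis sums to 1, so its derivatives cancel: the scheme annihilates
  constants.\<close>

lemma kint_sum_eq_0:
  assumes "0 \<le> b" "b \<le> D"
  shows "kint \<nu> b 1 (-3 / 2) D + kint \<nu> b (-2) 2 D + kint \<nu> b 1 (-1 / 2) D = 0"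
  using kint_linear_combination[OF assms, of 1 1 1 "-2" 1 1 "-3 / 2" 2 "-1 / 2"]
  by (simp add: kint_def)

definition kunit :: real where
  "kunit = 2 powr (-\<nu>) / ((1 - \<nu>) * (2 - \<nu>))"

lemma kunit_pos: "kunit > 0"
  using nu by (simp add: kunit_def)

lemma two_powr_eq_kunit: "2 powr (-\<nu>) = (1 - \<nu>) * (2 - \<nu>) * kunit"
  using nu by (simp add: kunit_def)

lemma kint_first:
  shows "kint \<nu> 2 1 (-3 / 2) 2 = (3 * \<nu> - 2) * kunit"
    and "kint \<nu> 2 (-2) 2 2 = -4 * \<nu> * kunit"
    and "kint \<nu> 2 1 (-1 / 2) 2 = (2 + \<nu>) * kunit"
proof -
  have p: "2 powr (1 - \<nu>) = 2 * 2 powr (-\<nu>)" "2 powr (2 - \<nu>) = 4 * 2 powr (-\<nu>)"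
    by (simp_all add: powr_diff powr_minus_divide)
  show "kint \<nu> 2 1 (-3 / 2) 2 = (3 * \<nu> - 2) * kunit"
    "kint \<nu> 2 (-2) 2 2 = -4 * \<nu> * kunit" "kint \<nu> 2 1 (-1 / 2) 2 = (2 + \<nu>) * kunit"
    using nu by (simp_all add: kint_closed p two_powr_eq_kunit) (simp_all add: field_simps)
qed

lemma kint_half:
  "kint \<nu> 1 p q 1 = (p + q) / (1 - \<nu>) - p / (2 - \<nu>)"
  using nu by (simp add: kint_closed)

section \<open>Estimates for full stencils\<close>

text \<open>Since 3/2 - r has integral 1 over [0, 2], replacing the kernel by its value at r = 0
  gives exactly the bound. The rest of the kernel grows with slope between a and 2 a, as r / D is at
  most 1/2, and the comparison integral applies.\<close>

lemma kint_left_le: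
  assumes "D \<ge> 4"
  shows "kint \<nu> 2 1 (-3 / 2) D \<le> - (D powr (-\<nu>))"
proof -
  let ?c = "D powr (-\<nu>)"
  have "((\<lambda>r. - ((1 * r + -3 / 2) * (D - r) powr (-\<nu>)) - ?c * (3 / 2 + (-1) * r + 0 * r\<^sup>2))
      has_integral - kint \<nu> 2 1 (-3 / 2) D - ?c * (3 / 2 * 2 + (-1) * 2\<^sup>2 / 2 + 0 * 2 ^ 3 / 3)) {0..2}"
    using assms
    by (intro has_integral_diff has_integral_neg has_integral_mult_right
          has_integral_quadratic has_integral_kint) auto
  hence int: "((\<lambda>r. (3 / 2 - r) * ((D - r) powr (-\<nu>) - ?c))
      has_integral - kint \<nu> 2 1 (-3 / 2) D - ?c) {0..2}"
    by (simp add: algebra_simps)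
  have bounds: "?c * \<nu> / D * r \<le> (D - r) powr (-\<nu>) - ?c \<and>
      (D - r) powr (-\<nu>) - ?c \<le> 2 * (?c * \<nu> / D) * r" if r: "0 \<le> r" "r < 2" for r
  proof -
    define x y where "x = r / D" and "y = 1 - x"
    have x: "0 \<le> x" "x \<le> 1 / 2" using r assms by (auto simp: x_def field_simps)
    have y: "y \<ge> 1 / 2" "1 - y = x" using x by (auto simp: y_def)
    have "(D - r) / D = y" using assms by (simp add: x_def y_def field_simps)
    hence e: "(D - r) powr (-\<nu>) = ?c * y powr (-\<nu>)"
      using r assms powr_uminus_scale[of D "D - r" \<nu>] by simp
    have "1 + \<nu> * x \<le> y powr (-\<nu>)"
      using powr_uminus_ge[of y \<nu>] y nu by simp
    moreover have "y powr (-\<nu>) \<le> 1 + \<nu> * x / y"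
      using powr_uminus_le[of y \<nu>] y nu by simp
    moreover have "\<nu> * x / y \<le> \<nu> * x / (1 / 2)"
      using x y nu by (intro divide_left_mono) auto
    ultimately have bounds: "1 + \<nu> * x \<le> y powr (-\<nu>)" "y powr (-\<nu>) \<le> 1 + 2 * (\<nu> * x)"
      by simp_all
    have "?c * (1 + \<nu> * x) \<le> (D - r) powr (-\<nu>)"
      unfolding e by (rule mult_left_mono[OF bounds(1) powr_ge_zero])
    moreover have "(D - r) powr (-\<nu>) \<le> ?c * (1 + 2 * (\<nu> * x))"
      unfolding e by (rule mult_left_mono[OF bounds(2) powr_ge_zero])
    ultimately show ?thesis by (simp add: x_def algebra_simps)
  qed
  have "- kint \<nu> 2 1 (-3 / 2) D - ?c \<ge> 0"
  proof (rule integral_three_halves_minus_nonneg[OF _ _ _ int])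
    show "0 \<le> ?c * \<nu> / D" using nu assms by simp
  qed (use bounds in blast)+
  thus ?thesis by simp
qed

text \<open>This is the total weight of an even node shared by two stencils. After reflection the
  sum is minus the integral of 3/2 - r against the difference of the kernel at l - r and l + r,
  which vanishes at r = 0 and grows almost linearly.\<close>

lemma kint_even_le_0:
  assumes "l \<ge> 4"
  shows "kint \<nu> 2 1 (-3 / 2) l + kint \<nu> 2 1 (-1 / 2) (l + 2) \<le> 0"
proof -
  let ?c = "l powr (-\<nu>)"
  have "((\<lambda>r. - ((1 * r + -3 / 2) * (l - r) powr (-\<nu>)) - (3 / 2 - r) * (l + 2 - 2 + r) powr (-\<nu>))
      has_integral - kint \<nu> 2 1 (-3 / 2) l - kint \<nu> 2 1 (-1 / 2) (l + 2)) {0..2}"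
    using assms
    by (intro has_integral_diff has_integral_neg has_integral_kint has_integral_kint_reflected) auto
  hence int: "((\<lambda>r. (3 / 2 - r) * ((l - r) powr (-\<nu>) - (l + r) powr (-\<nu>)))
      has_integral - kint \<nu> 2 1 (-3 / 2) l - kint \<nu> 2 1 (-1 / 2) (l + 2)) {0..2}"
    by (simp add: algebra_simps)
  have bounds: "3 / 2 * \<nu> * ?c / l * r \<le> (l - r) powr (-\<nu>) - (l + r) powr (-\<nu>) \<and>
      (l - r) powr (-\<nu>) - (l + r) powr (-\<nu>) \<le> 2 * (3 / 2 * \<nu> * ?c / l) * r"
    if r: "0 \<le> r" "r < 2" for r
  proof -
    define x y z where "x = r / l" and "y = 1 - x" and "z = 1 + x"
    have x: "0 \<le> x" "x \<le> 1 / 2" using r assms by (auto simp: x_def field_simps)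
    have y: "y \<ge> 1 / 2" "1 - y = x" using x by (auto simp: y_def)
    have z: "0 < z" "z \<le> 3 / 2" "1 - z = - x" using x by (auto simp: z_def)
    have "(l - r) / l = y" "(l + r) / l = z"
      using assms by (simp_all add: x_def y_def z_def field_simps)
    hence "(l - r) powr (-\<nu>) = ?c * y powr (-\<nu>)" "(l + r) powr (-\<nu>) = ?c * z powr (-\<nu>)"
      using r assms powr_uminus_scale[of l "l - r" \<nu>] powr_uminus_scale[of l "l + r" \<nu>] by auto
    hence e: "(l - r) powr (-\<nu>) - (l + r) powr (-\<nu>) = ?c * (y powr (-\<nu>) - z powr (-\<nu>))"
      by (simp add: algebra_simps)
    have "1 + \<nu> * x \<le> y powr (-\<nu>)"
      using powr_uminus_ge[of y \<nu>] y nu by simp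
    moreover have "y powr (-\<nu>) \<le> 1 + \<nu> * x / y"
      using powr_uminus_le[of y \<nu>] y nu by simp
    moreover have "\<nu> * x / y \<le> \<nu> * x / (1 / 2)"
      using x y nu by (intro divide_left_mono) auto
    moreover have "1 - \<nu> * x \<le> z powr (-\<nu>)"
      using powr_uminus_ge[of z \<nu>] z nu by simp
    moreover have "z powr (-\<nu>) \<le> 1 - \<nu> * x / z"
      using powr_uminus_le[of z \<nu>] z nu by simp
    moreover have "\<nu> * x / (3 / 2) \<le> \<nu> * x / z"
      using x z nu by (intro divide_left_mono) auto
    moreover have "\<nu> * x \<ge> 0" using nu x by auto
    \<comment> \<open>The collected lower slope is 1 + 2/3 = 5/3; it is relaxed to 3/2, half of the
      upper slope 3.\<close>
    ultimately have bounds: "3 / 2 * (\<nu> * x) \<le> y powr (-\<nu>) - z powr (-\<nu>)"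
      "y powr (-\<nu>) - z powr (-\<nu>) \<le> 3 * (\<nu> * x)"
      by simp_all
    have "?c * (3 / 2 * (\<nu> * x)) \<le> (l - r) powr (-\<nu>) - (l + r) powr (-\<nu>)"
      unfolding e by (rule mult_left_mono[OF bounds(1) powr_ge_zero])
    moreover have "(l - r) powr (-\<nu>) - (l + r) powr (-\<nu>) \<le> ?c * (3 * (\<nu> * x))"
      unfolding e by (rule mult_left_mono[OF bounds(2) powr_ge_zero])
    ultimately show ?thesis by (simp add: x_def algebra_simps)
  qed
  have "- kint \<nu> 2 1 (-3 / 2) l - kint \<nu> 2 1 (-1 / 2) (l + 2) \<ge> 0"
  proof (rule integral_three_halves_minus_nonneg[OF _ _ _ int])
    show "0 \<le> 3 / 2 * \<nu> * ?c / l" using nu assms by simp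
  qed (use bounds in blast)+
  thus ?thesis by simp
qed

lemma kint_right_4_le: "kint \<nu> 2 1 (-1 / 2) 4 \<le> 2 powr (-\<nu>)"
proof -
  let ?c = "2 powr (-\<nu>)"
  have "((\<lambda>r. ?c * (3 / 2 + (-1) * r + 0 * r\<^sup>2) - (3 / 2 - r) * (4 - 2 + r) powr (-\<nu>))
      has_integral ?c * (3 / 2 * 2 + (-1) * 2\<^sup>2 / 2 + 0 * 2 ^ 3 / 3) - kint \<nu> 2 1 (-1 / 2) 4) {0..2}"
    by (intro has_integral_diff has_integral_mult_right has_integral_quadratic
          has_integral_kint_reflected) auto
  hence int: "((\<lambda>r. (3 / 2 - r) * (?c - (2 + r) powr (-\<nu>)))
      has_integral ?c - kint \<nu> 2 1 (-1 / 2) 4) {0..2}"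
    by (simp add: algebra_simps)
  have bounds: "?c * \<nu> / 4 * r \<le> ?c - (2 + r) powr (-\<nu>) \<and>
      ?c - (2 + r) powr (-\<nu>) \<le> 2 * (?c * \<nu> / 4) * r" if r: "0 \<le> r" "r < 2" for r
  proof -
    define x z where "x = r / 2" and "z = 1 + x"
    have x: "0 \<le> x" using r by (simp add: x_def)
    have z: "0 < z" "z \<le> 2" "1 - z = - x" using r by (auto simp: z_def x_def)
    have "(2 + r) / 2 = z" by (simp add: x_def z_def field_simps)
    hence e: "(2 + r) powr (-\<nu>) = ?c * z powr (-\<nu>)"
      using r powr_uminus_scale[of 2 "2 + r" \<nu>] by simp
    have lower: "1 - \<nu> * x \<le> z powr (-\<nu>)"
      using powr_uminus_ge[of z \<nu>] z nu by simp
    have "z powr (-\<nu>) \<le> 1 - \<nu> * x / z"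
      using powr_uminus_le[of z \<nu>] z nu by simp
    moreover have "\<nu> * x / 2 \<le> \<nu> * x / z"
      using x z nu by (intro divide_left_mono) auto
    ultimately have upper: "z powr (-\<nu>) \<le> 1 - \<nu> * x / 2"
      by linarith
    have "?c * (1 - \<nu> * x) \<le> (2 + r) powr (-\<nu>)"
      unfolding e by (rule mult_left_mono[OF lower powr_ge_zero])
    moreover have "(2 + r) powr (-\<nu>) \<le> ?c * (1 - \<nu> * x / 2)"
      unfolding e by (rule mult_left_mono[OF upper powr_ge_zero])
    ultimately show ?thesis by (simp add: x_def algebra_simps)
  qed
  have "?c - kint \<nu> 2 1 (-1 / 2) 4 \<ge> 0"
  proof (rule integral_three_halves_minus_nonneg[OF _ _ _ int])
    show "0 \<le> ?c * \<nu> / 4" using nu by simp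
  qed (use bounds in blast)+
  thus ?thesis by simp
qed

text \<open>In t = r - 1 the factor -2 t is odd, so the constant part of the kernel integrates to 0.
  Its growth contributes at least \<nu> t / D relative to the midpoint value, with the same D for
  both signs of t, and -2 t^2 integrates to -4/3. This strict gain later pays for a half-stencil
  term.\<close>

lemma kint_middle_le:
  assumes "D \<ge> 3"
  shows "kint \<nu> 2 (-2) 2 D \<le> - 4 / 3 * (\<nu> * (D - 1) powr (-\<nu>) / D)"
proof -
  let ?d = "D - 1"
  let ?c = "?d powr (-\<nu>)"
  let ?e = "\<nu> * ?c / D"
  have "((\<lambda>r. (2 * ?c - 2 * ?e) + (4 * ?e - 2 * ?c) * r + (- 2 * ?e) * r\<^sup>2) has_integral
      (2 * ?c - 2 * ?e) * 2 + (4 * ?e - 2 * ?c) * 2\<^sup>2 / 2 + (- 2 * ?e) * 2 ^ 3 / 3) {0..2}"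
    by (rule has_integral_quadratic) auto
  moreover have "((-2) * r + 2) * (D - r) powr (-\<nu>) \<le>
      (2 * ?c - 2 * ?e) + (4 * ?e - 2 * ?c) * r + (- 2 * ?e) * r\<^sup>2" if r: "r \<in> {0..2}" for r
  proof -
    define t where "t = r - 1"
    define y where "y = (?d - t) / ?d"
    have t: "-1 \<le> t" "t \<le> 1" "D - r = ?d - t" using r by (auto simp: t_def)
    have y: "y > 0" "1 - y = t / ?d" using t assms by (auto simp: y_def field_simps)
    have e: "(D - r) powr (-\<nu>) = ?c * y powr (-\<nu>)"
      unfolding t(3) y_def using t assms by (intro powr_uminus_scale) auto
    have "t * (1 + \<nu> * t / D) \<le> t * y powr (-\<nu>)"
    proof (cases "t \<ge> 0")
      case True
      have "\<nu> * t / D \<le> \<nu> * t / ?d"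
        using True nu assms by (intro divide_left_mono) auto
      thus ?thesis using True powr_uminus_ge[of y \<nu>] y nu by (intro mult_left_mono) auto
    next
      case False
      have "y powr (-\<nu>) \<le> 1 + \<nu> * (t / ?d) / y"
        using powr_uminus_le[of y \<nu>] y nu by simp
      also have "\<nu> * (t / ?d) / y = \<nu> * t / (?d - t)"
        using t assms by (simp add: y_def)
      also have "\<dots> \<le> \<nu> * t / D"
        using False t nu assms by (intro divide_left_mono_neg) (auto simp: mult_nonneg_nonpos)
      finally show ?thesis using False by (intro mult_left_mono_neg) auto
    qed
    hence "?c * (t * (1 + \<nu> * t / D)) \<le> ?c * (t * y powr (-\<nu>))"
      by (rule mult_left_mono) auto
    hence le: "?c * t + ?e * t\<^sup>2 \<le> t * (D - r) powr (-\<nu>)"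
      unfolding e by (simp add: algebra_simps power2_eq_square)
    have "((-2) * r + 2) * (D - r) powr (-\<nu>) = -2 * (t * (D - r) powr (-\<nu>))"
      by (simp add: t_def algebra_simps)
    also have "\<dots> \<le> -2 * (?c * t + ?e * t\<^sup>2)"
      by (rule mult_left_mono_neg[OF le]) simp
    also have "\<dots> = (2 * ?c - 2 * ?e) + (4 * ?e - 2 * ?c) * r + (- 2 * ?e) * r\<^sup>2"
      unfolding t_def by (simp only: power2_eq_square) argo
    finally show ?thesis .
  qed
  ultimately have le: "kint \<nu> 2 (-2) 2 D \<le>
      (2 * ?c - 2 * ?e) * 2 + (4 * ?e - 2 * ?c) * 2\<^sup>2 / 2 + (- 2 * ?e) * 2 ^ 3 / 3"
    using assms by (intro has_integral_le[OF has_integral_kint]) auto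
  have eq: "(2 * c - 2 * e) * 2 + (4 * e - 2 * c) * 2\<^sup>2 / 2 + (- 2 * e) * 2 ^ 3 / 3 = - 4 / 3 * e"
    for c e :: real by (simp add: field_simps)
  show ?thesis using le unfolding eq .
qed

section \<open>Estimates for the half stencil at the left end\<close>

lemma kint_half_left_le_0:
  assumes "D \<ge> 1"
  shows "kint \<nu> 1 1 (-3 / 2) D \<le> 0"
  using assms
  by (intro has_integral_le[OF has_integral_kint has_integral_0]) (auto simp: mult_nonpos_nonneg)

lemma kint_half_middle_le:
  assumes "D > 0"
  shows "kint \<nu> 1 (-2) 2 (D + 1) \<le> D powr (-\<nu>) * (1 - 2 / 3 * \<nu> / (D + 1))"
proof -
  let ?c = "D powr (-\<nu>)"
  let ?e = "?c * (\<nu> / (D + 1))"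
  have "((\<lambda>r. (2 * ?c - 2 * ?e) + (4 * ?e - 2 * ?c) * r + (- 2 * ?e) * r\<^sup>2) has_integral
      (2 * ?c - 2 * ?e) * 1 + (4 * ?e - 2 * ?c) * 1\<^sup>2 / 2 + (- 2 * ?e) * 1 ^ 3 / 3) {0..1}"
    by (rule has_integral_quadratic) auto
  moreover have "((-2) * r + 2) * (D + 1 - r) powr (-\<nu>) \<le>
      (2 * ?c - 2 * ?e) + (4 * ?e - 2 * ?c) * r + (- 2 * ?e) * r\<^sup>2" if r: "r \<in> {0..1}" for r
  proof -
    define s where "s = 1 - r"
    define y where "y = (D + s) / D"
    have s: "0 \<le> s" "s \<le> 1" "D + 1 - r = D + s" using r by (auto simp: s_def)
    have y: "y > 0" "1 - y = - (s / D)" using s assms by (auto simp: y_def field_simps)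
    have e: "(D + 1 - r) powr (-\<nu>) = ?c * y powr (-\<nu>)"
      unfolding s(3) y_def using s assms by (intro powr_uminus_scale) auto
    have "y powr (-\<nu>) \<le> 1 - \<nu> * (s / D) / y"
      using powr_uminus_le[of y \<nu>] y nu by simp
    also have "\<nu> * (s / D) / y = \<nu> * s / (D + s)"
      using s assms by (simp add: y_def)
    also have "1 - \<nu> * s / (D + s) \<le> 1 - \<nu> * s / (D + 1)"
      using s assms nu by (intro diff_left_mono divide_left_mono) auto
    finally have "(2 * s * ?c) * y powr (-\<nu>) \<le> (2 * s * ?c) * (1 - \<nu> * s / (D + 1))"
      using s by (intro mult_left_mono) auto
    hence "2 * s * (D + 1 - r) powr (-\<nu>) \<le> 2 * s * ?c - 2 * ?e * s\<^sup>2"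
      unfolding e by (simp add: algebra_simps power2_eq_square)
    also have "\<dots> = (2 * ?c - 2 * ?e) + (4 * ?e - 2 * ?c) * r + (- 2 * ?e) * r\<^sup>2"
      by (simp add: s_def algebra_simps power2_eq_square diff_divide_distrib add_divide_distrib)
    finally show ?thesis by (simp add: s_def algebra_simps)
  qed
  ultimately have "kint \<nu> 1 (-2) 2 (D + 1) \<le>
      (2 * ?c - 2 * ?e) * 1 + (4 * ?e - 2 * ?c) * 1\<^sup>2 / 2 + (- 2 * ?e) * 1 ^ 3 / 3"
    using assms by (intro has_integral_le[OF has_integral_kint]) auto
  also have "\<dots> = ?c - 2 / 3 * ?e"
  proof -
    have "(2 * c - 2 * e) * 1 + (4 * e - 2 * c) * 1\<^sup>2 / 2 + (- 2 * e) * 1 ^ 3 / 3 = c - 2 / 3 * e"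
      for c e :: real by (simp add: field_simps)
    thus ?thesis .
  qed
  also have "\<dots> = ?c * (1 - 2 / 3 * \<nu> / (D + 1))" by (simp add: right_diff_distrib)
  finally show ?thesis .
qed

text \<open>The factor r - 1/2 has integral 0 over [0, 1] and is at most 1/2, so only the
  oscillation of the kernel counts; that is at most \<nu> / D times its largest value.\<close>

lemma kint_half_right_le:
  assumes "D > 0"
  shows "kint \<nu> 1 1 (-1 / 2) (D + 1) \<le> \<nu> * D powr (-\<nu>) / (2 * D)"
proof -
  let ?c = "D powr (-\<nu>)"
  let ?f = "?c * (1 - \<nu> / D)"
  have "((\<lambda>r. (?c * \<nu> / (2 * D) - ?f / 2) + ?f * r + 0 * r\<^sup>2) has_integral
      (?c * \<nu> / (2 * D) - ?f / 2) * 1 + ?f * 1\<^sup>2 / 2 + 0 * 1 ^ 3 / 3) {0..1}"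
    by (rule has_integral_quadratic) auto
  moreover have "(1 * r + -1 / 2) * (D + 1 - r) powr (-\<nu>) \<le>
      (?c * \<nu> / (2 * D) - ?f / 2) + ?f * r + 0 * r\<^sup>2" if r: "r \<in> {0..1}" for r
  proof -
    let ?k = "(D + 1 - r) powr (-\<nu>)"
    define y where "y = (D + 1 - r) / D"
    have y: "y > 0" "1 - y \<ge> - (1 / D)" using r assms by (auto simp: y_def field_simps)
    have e: "?k = ?c * y powr (-\<nu>)"
      unfolding y_def using r assms by (intro powr_uminus_scale) auto
    have "?k \<le> ?c"
      using r assms nu by (intro powr_mono2') auto
    moreover have "1 - \<nu> / D \<le> y powr (-\<nu>)"
    proof -
      have "\<nu> * - (1 / D) \<le> \<nu> * (1 - y)" using y nu by (intro mult_left_mono) auto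
      thus ?thesis using powr_uminus_ge[of y \<nu>] y nu by simp
    qed
    hence "?f \<le> ?k"
      unfolding e by (intro mult_left_mono) auto
    ultimately have "(r - 1 / 2) * (?k - ?f) \<le> 1 / 2 * (?c - ?f)"
      using r by (intro mult_mono) auto
    moreover have "1 / 2 * (?c - ?f) = ?c * \<nu> / (2 * D)"
      by (simp add: algebra_simps)
    ultimately have "(r - 1 / 2) * ?k \<le> ?c * \<nu> / (2 * D) + (r - 1 / 2) * ?f"
      by (simp only: right_diff_distrib)
    also have "\<dots> = (?c * \<nu> / (2 * D) - ?f / 2) + ?f * r + 0 * r\<^sup>2"
      by (simp only: left_diff_distrib) simp
    finally show ?thesis by simp
  qed
  ultimately have "kint \<nu> 1 1 (-1 / 2) (D + 1) \<le>
      (?c * \<nu> / (2 * D) - ?f / 2) * 1 + ?f * 1\<^sup>2 / 2 + 0 * 1 ^ 3 / 3"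
    using assms by (intro has_integral_le[OF has_integral_kint]) auto
  thus ?thesis by (simp add: algebra_simps)
qed

end

section \<open>Deflated weights and the energy inequality\<close>

text \<open>Coefficients of the quotient of the generating function of \<open>W\<close> by \<open>1 - \<eta> z\<close>.\<close>

primrec deflate :: "real \<Rightarrow> (nat \<Rightarrow> real) \<Rightarrow> nat \<Rightarrow> real" where
  "deflate \<eta> W 0 = W 0"
| "deflate \<eta> W (Suc l) = W (Suc l) + \<eta> * deflate \<eta> W l"

text \<open>Summation by parts. With \<open>u l = z (n - l)\<close> the undifferenced last term
  carries the initial value, which has no predecessor.\<close>

lemma sum_deflate:
  "(\<Sum>l\<le>n. W l * u l) =
    (\<Sum>l<n. deflate \<eta> W l * (u l - \<eta> * u (Suc l))) + deflate \<eta> W n * u n"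
  by (induction n) (simp_all add: algebra_simps)

text \<open>Only l = 1 and l = 2 need separate checks, since \<open>W 2\<close> may be positive;
  from then on the recursion preserves the sign.\<close>

lemma deflate_nonpos:
  assumes "0 \<le> \<eta>" "deflate \<eta> W 1 \<le> 0" "deflate \<eta> W 2 \<le> 0"
    and "\<And>l. 3 \<le> l \<Longrightarrow> l \<le> j \<Longrightarrow> W l \<le> 0"
    and "1 \<le> l" "l \<le> j"
  shows "deflate \<eta> W l \<le> 0"
  using assms(5,6)
proof (induction l rule: dec_induct)
  case base
  show ?case by (rule assms(2))
next
  case (step l)
  show ?case
  proof (cases "l = 1")
    case True
    thus ?thesis using assms(3) by (simp add: numeral_2_eq_2)
  next
    case False
    hence "W (Suc l) \<le> 0" using step by (intro assms(4)) auto
    moreover have "\<eta> * deflate \<eta> W l \<le> 0"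
      using step assms(1) by (intro mult_nonneg_nonpos) auto
    ultimately show ?thesis by simp
  qed
qed

text \<open>The energy step tests the scheme with the difference \<open>z j - \<eta> z (j - 1)\<close>.  The term
  \<open>\<mu> \<eta>\<^sup>2 (z (j - 1))\<^sup>2\<close> that this produces is absorbed by the \<open>\<mu>\<close>-part of the
  bound for index \<open>j - 1\<close>, whose weight is at least \<open>\<eta>\<^sup>2\<close>.\<close>

lemma energy_step:
  fixes W z :: "nat \<Rightarrow> real" and \<eta> \<mu> M :: real
  defines "c \<equiv> deflate \<eta> W"
  assumes j: "j \<ge> 2" and eta: "0 \<le> \<eta>" "\<eta> < 1" and mu: "\<mu> \<ge> 0"
    and sum0: "(\<Sum>l\<le>j. W l) = 0"
    and c0: "W 0 > 0" and c1: "c 1 \<le> - (\<eta>\<^sup>2 * W 0)"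
    and neg: "\<And>l. 1 \<le> l \<Longrightarrow> l \<le> j \<Longrightarrow> c l \<le> 0"
    and eq: "(\<Sum>l\<le>j. W l * z (j - l)) = - \<mu> * z j"
    and z0: "(z 0)\<^sup>2 \<le> M"
    and IH: "\<And>k. 1 \<le> k \<Longrightarrow> k < j \<Longrightarrow> W 0 * (z k - \<eta> * z (k - 1))\<^sup>2 + \<mu> * (z k)\<^sup>2 \<le> W 0 * M"
  shows "W 0 * (z j - \<eta> * z (j - 1))\<^sup>2 + \<mu> * (z j)\<^sup>2 \<le> W 0 * M"
proof -
  define v where "v l = z (j - l) - \<eta> * z (j - Suc l)" for l
  define S where "S = (\<Sum>l=1..<j. - c l)"
  let ?E = "\<mu> * \<eta>\<^sup>2 * (z (j - 1))\<^sup>2"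
  have split: "(\<Sum>l<j. f l) = f 0 + (\<Sum>l=1..<j. f l)" for f :: "nat \<Rightarrow> real"
    using j by (simp add: sum.atLeast_Suc_lessThan flip: atLeast0LessThan)
  have c00: "c 0 = W 0" by (simp add: c_def)
  \<comment> \<open>Let A be the sum of \<open>c l\<close> over l < j. The zero row sum gives
    \<open>- c j = (1 - \<eta>) * A\<close>, hence A >= 0, and the total of the negated coefficients
    is \<open>W 0 - \<eta> * A\<close>.\<close>
  have "0 = (1 - \<eta>) * (\<Sum>l<j. c l) + c j"
    using sum_deflate[of W "\<lambda>_. 1" j \<eta>] sum0 by (simp add: c_def sum_distrib_left mult.commute)
  hence cj: "- c j = (1 - \<eta>) * (\<Sum>l<j. c l)" by simp
  moreover have "- c j \<ge> 0" using neg[of j] j by simp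
  ultimately have "(\<Sum>l<j. c l) \<ge> 0" using eta by (simp add: zero_le_mult_iff)
  moreover have "(\<Sum>l<j. c l) = W 0 - S" by (simp add: split c00 S_def sum_negf)
  ultimately have tot: "S - c j \<le> W 0"
    using cj eta mult_nonneg_nonneg[of \<eta> "\<Sum>l<j. c l"] by (simp add: algebra_simps)
  have "- \<mu> * z j = (\<Sum>l<j. c l * v l) + c j * z 0"
    using sum_deflate[of W "\<lambda>l. z (j - l)" j \<eta>] eq by (simp add: c_def v_def)
  hence "W 0 * v 0 + \<mu> * z j = (\<Sum>l=1..<j. - c l * v l) + - c j * z 0"
    by (simp add: split c00 sum_negf)
  hence "2 * v 0 * (W 0 * v 0 + \<mu> * z j) = 2 * v 0 * ((\<Sum>l=1..<j. - c l * v l) + - c j * z 0)"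
    by simp
  hence "2 * W 0 * (v 0)\<^sup>2 + \<mu> * (2 * z j * v 0) =
      (\<Sum>l=1..<j. - c l * (2 * v 0 * v l)) + - c j * (2 * v 0 * z 0)"
    by (simp add: algebra_simps power2_eq_square sum_distrib_left)
  also have "(\<Sum>l=1..<j. - c l * (2 * v 0 * v l)) \<le>
      (\<Sum>l=1..<j. - c l * (v 0)\<^sup>2 + - c l * M - (if l = 1 then ?E else 0))"
  proof (rule sum_mono)
    fix l assume l: "l \<in> {1..<j}"
    have "W 0 * (v l)\<^sup>2 \<le> W 0 * M - \<mu> * (z (j - l))\<^sup>2"
    proof -
      have "1 \<le> j - l" "j - l < j" using l by auto
      from IH[OF this] show ?thesis by (simp add: v_def)
    qed
    hence v: "(v l)\<^sup>2 \<le> M - \<mu> * (z (j - l))\<^sup>2 / W 0"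
      using c0 by (simp add: field_simps)
    have E: "(if l = 1 then ?E else 0) \<le> - c l * (\<mu> * (z (j - l))\<^sup>2 / W 0)"
    proof (cases "l = 1")
      case True
      have "\<eta>\<^sup>2 * W 0 * (\<mu> * (z (j - 1))\<^sup>2 / W 0) \<le> - c 1 * (\<mu> * (z (j - 1))\<^sup>2 / W 0)"
        using c1 mu c0 by (intro mult_right_mono) auto
      thus ?thesis using True c0 by (simp add: mult_ac)
    next
      case False
      have "0 \<le> - c l * (\<mu> * (z (j - l))\<^sup>2 / W 0)"
        using neg[of l] l mu c0 by (intro mult_nonneg_nonneg divide_nonneg_nonneg) auto
      thus ?thesis using False by simp
    qed
    have "2 * v 0 * v l \<le> (v 0)\<^sup>2 + (v l)\<^sup>2" by (rule sum_squares_bound)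
    hence "- c l * (2 * v 0 * v l) \<le> - c l * ((v 0)\<^sup>2 + (M - \<mu> * (z (j - l))\<^sup>2 / W 0))"
      using neg[of l] l v by (intro mult_left_mono) auto
    thus "- c l * (2 * v 0 * v l) \<le> - c l * (v 0)\<^sup>2 + - c l * M - (if l = 1 then ?E else 0)"
      using E by (simp only: distrib_left right_diff_distrib)
  qed
  also have "\<dots> = S * (v 0)\<^sup>2 + S * M - ?E"
    using j by (simp add: sum.distrib sum_subtractf S_def sum_distrib_right sum_negf)
  also have "- c j * (2 * v 0 * z 0) \<le> - c j * ((v 0)\<^sup>2 + M)"
    using neg[of j] j sum_squares_bound[of "v 0" "z 0"] z0 by (intro mult_left_mono) auto
  finally have "2 * W 0 * (v 0)\<^sup>2 + \<mu> * (2 * z j * v 0) \<le> (S - c j) * ((v 0)\<^sup>2 + M) - ?E"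
    by (simp add: algebra_simps)
  also have "\<dots> \<le> W 0 * ((v 0)\<^sup>2 + M) - ?E"
    using tot z0 by (intro diff_right_mono mult_right_mono)
      (auto intro: add_nonneg_nonneg order_trans[OF zero_le_power2])
  finally have "W 0 * (v 0)\<^sup>2 + \<mu> * (2 * z j * v 0 + \<eta>\<^sup>2 * (z (j - 1))\<^sup>2) \<le> W 0 * M"
    by (simp add: algebra_simps)
  \<comment> \<open>Completing the square: the damping term tested with \<open>v 0\<close> becomes a
    sum of squares once the square of the previous value has been added.\<close>
  moreover have "2 * z j * v 0 + \<eta>\<^sup>2 * (z (j - 1))\<^sup>2 = (z j)\<^sup>2 + (v 0)\<^sup>2"
    by (simp add: v_def power2_eq_square algebra_simps)
  moreover have "\<mu> * (z j)\<^sup>2 \<le> \<mu> * ((z j)\<^sup>2 + (v 0)\<^sup>2)"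
    using mu by (intro mult_left_mono) auto
  ultimately show ?thesis by (simp add: v_def)
qed

section \<open>Weights as functions of the distance to the evaluation point\<close>

text \<open>The contribution to the scaled derivative of the quadratic with nodal values \<open>x, y, z\<close>,
  taken over the first \<open>b\<close> steps of its stencil, whose left end lies \<open>D\<close> steps before the
  evaluation point.\<close>

definition quad_term :: "real \<Rightarrow> real \<Rightarrow> real \<Rightarrow> real \<Rightarrow> real \<Rightarrow> real \<Rightarrow> real" where
  "quad_term \<nu> b D x y z =
     kint \<nu> b 1 (-3 / 2) D * x + kint \<nu> b (-2) 2 D * y + kint \<nu> b 1 (-1 / 2) D * z"

text \<open>The index l counts steps back from the evaluation point. Odd nodes are midpoints of one
  stencil; even nodes join two stencils, except l = 0. The weights do not depend on j; only the left
  end of the grid deviates from them.\<close>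

definition weight :: "real \<Rightarrow> nat \<Rightarrow> real" where
  "weight \<nu> l = (if odd l then kint \<nu> 2 (-2) 2 (real l + 1)
     else (if l = 0 then 0 else kint \<nu> 2 1 (-3 / 2) (real l)) + kint \<nu> 2 1 (-1 / 2) (real l + 2))"

lemma sum_quad_term:
  assumes "m \<ge> 1"
  shows "(\<Sum>i<m. quad_term \<nu> 2 (real (2 * i + 2)) (u (2 * i + 2)) (u (2 * i + 1)) (u (2 * i))) =
    (\<Sum>l<2 * m. weight \<nu> l * u l) + kint \<nu> 2 1 (-3 / 2) (real (2 * m)) * u (2 * m)"
  using assms
proof (induction m rule: dec_induct)
  case base
  show ?case by (simp add: quad_term_def weight_def numeral_2_eq_2)
next
  case (step m)
  have "(\<Sum>l<2 * Suc m. weight \<nu> l * u l) = (\<Sum>l<2 * m. weight \<nu> l * u l)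
      + weight \<nu> (2 * m) * u (2 * m) + weight \<nu> (2 * m + 1) * u (2 * m + 1)"
    by simp
  thus ?case
    using step by (simp add: quad_term_def weight_def algebra_simps)
qed

context
  fixes \<nu> :: real
  assumes nu: "0 < \<nu>" "\<nu> < 1"
begin

lemma quad_term_const:
  assumes "0 \<le> b" "b \<le> D"
  shows "quad_term \<nu> b D x x x = 0"
  using kint_sum_eq_0[OF nu assms] by (simp add: quad_term_def flip: distrib_right)

lemma weight_first:
  shows "weight \<nu> 0 = (2 + \<nu>) * kunit \<nu>"
    and "weight \<nu> 1 = -4 * \<nu> * kunit \<nu>"
  using kint_first[OF nu] by (simp_all add: weight_def)

lemma kint_middle_nonpos:
  assumes "D \<ge> 3"
  shows "kint \<nu> 2 (-2) 2 D \<le> 0"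
proof -
  have "\<nu> * (D - 1) powr (-\<nu>) / D \<ge> 0" using nu assms by simp
  thus ?thesis using kint_middle_le[OF nu assms] by simp
qed

lemma weight_nonpos:
  assumes "l \<ge> 3"
  shows "weight \<nu> l \<le> 0"
proof (cases "odd l")
  case True
  thus ?thesis using assms kint_middle_nonpos by (simp add: weight_def)
next
  case False
  hence "l \<ge> 4" using assms by (cases "l = 3") auto
  thus ?thesis using False kint_even_le_0[OF nu, of "real l"] by (simp add: weight_def)
qed

text \<open>By \<open>two_powr_eq_kunit\<close> the two contributions add up to 3\<nu> - 2 + (1 -
  \<nu>)(2 - \<nu>) = \<nu>^2. This stays below the gain from deflation, 2\<nu>\<eta>, because \<nu>
  <= 2\<eta>.\<close>

lemma weight_2_le: "weight \<nu> 2 \<le> \<nu> * \<nu> * kunit \<nu>"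
proof -
  have "weight \<nu> 2 \<le> ((3 * \<nu> - 2) + (1 - \<nu>) * (2 - \<nu>)) * kunit \<nu>"
    using kint_first[OF nu] kint_right_4_le[OF nu] two_powr_eq_kunit[OF nu]
    by (simp add: weight_def algebra_simps)
  thus ?thesis by (simp add: algebra_simps)
qed

section \<open>The energy step for even and odd indices\<close>

lemma energy_step_even:
  fixes z :: "nat \<Rightarrow> real"
  defines "\<eta> \<equiv> 2 * \<nu> / (2 + \<nu>)"
  assumes j: "j = 2 * m" "m \<ge> 1" and mu: "\<mu> \<ge> 0"
    and eq: "(\<Sum>i<m. quad_term \<nu> 2 (real (2 * i + 2))
      (z (j - (2 * i + 2))) (z (j - (2 * i + 1))) (z (j - 2 * i))) = - \<mu> * z j"
    and z0: "(z 0)\<^sup>2 \<le> M"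
    and IH: "\<And>k. 1 \<le> k \<Longrightarrow> k < j \<Longrightarrow>
      weight \<nu> 0 * (z k - \<eta> * z (k - 1))\<^sup>2 + \<mu> * (z k)\<^sup>2 \<le> weight \<nu> 0 * M"
  shows "weight \<nu> 0 * (z j - \<eta> * z (j - 1))\<^sup>2 + \<mu> * (z j)\<^sup>2 \<le> weight \<nu> 0 * M"
proof -
  \<comment> \<open>The node x_0 belongs to a single stencil, so its weight lacks the right-node
    contribution.\<close>
  define W where "W l = (if l = j then kint \<nu> 2 1 (-3 / 2) (real j) else weight \<nu> l)" for l
  have W: "(\<Sum>l\<le>j. W l * u l) = (\<Sum>i<m. quad_term \<nu> 2 (real (2 * i + 2))
      (u (2 * i + 2)) (u (2 * i + 1)) (u (2 * i)))" for u
  proof -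
    have "(\<Sum>l<j. W l * u l) = (\<Sum>l<j. weight \<nu> l * u l)"
      by (intro sum.cong) (auto simp: W_def)
    thus ?thesis
      unfolding sum_quad_term[OF j(2)] lessThan_Suc_atMost[symmetric] sum.lessThan_Suc
      by (simp add: W_def j)
  qed
  have K: "kunit \<nu> > 0" by (rule kunit_pos[OF nu])
  have eta: "0 \<le> \<eta>" "\<eta> < 1" "\<eta> * (2 + \<nu>) = 2 * \<nu>"
    using nu by (auto simp: \<eta>_def)
  have eW: "\<eta> * weight \<nu> 0 = 2 * \<nu> * kunit \<nu>"
    unfolding weight_first mult.assoc[symmetric] eta(3) ..
  have eta2: "\<eta>\<^sup>2 * weight \<nu> 0 = 2 * \<nu> * \<eta> * kunit \<nu>"
    using eW by (simp add: power2_eq_square mult.assoc)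
  have W0: "W 0 = weight \<nu> 0" and W1: "W 1 = weight \<nu> 1"
    using j by (auto simp: W_def)
  have nu2: "\<nu> \<le> 2 * \<eta>" using nu by (simp add: \<eta>_def field_simps)
  have sq: "\<nu> * \<nu> * kunit \<nu> \<le> 2 * \<nu> * \<eta> * kunit \<nu>"
    using mult_left_mono[OF nu2, of "\<nu> * kunit \<nu>"] nu K by (simp add: mult_ac)
  have d1: "deflate \<eta> W 1 = - 2 * \<nu> * kunit \<nu>"
    using eW W0 W1 weight_first by simp
  have W2: "W 2 \<le> 2 * \<nu> * \<eta> * kunit \<nu>"
  proof (cases "j = 2")
    case True
    have "3 * \<nu> - 2 \<le> 2 * \<nu> * \<eta>"
    proof -
      \<comment> \<open>The difference of the two sides is (\<nu> - 2)^2.\<close>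
      have "(3 * \<nu> - 2) * (2 + \<nu>) \<le> 4 * \<nu>\<^sup>2"
        using zero_le_power2[of "\<nu> - 2"] by (simp add: algebra_simps power2_eq_square)
      thus ?thesis using nu by (simp add: \<eta>_def field_simps power2_eq_square)
    qed
    thus ?thesis using True K kint_first[OF nu] by (simp add: W_def)
  next
    case False
    thus ?thesis using weight_2_le sq by (simp add: W_def)
  qed
  have "deflate \<eta> W 2 = W 2 + \<eta> * deflate \<eta> W 1" by (simp add: numeral_2_eq_2)
  hence d2: "deflate \<eta> W 2 \<le> 0" using W2 d1 by (simp add: mult_ac)
  have neg: "W l \<le> 0" if "3 \<le> l" "l \<le> j" for l
  proof (cases "l = j")
    case True
    hence "j \<ge> 4" using that j by presburger
    thus ?thesis using True kint_left_le[OF nu, of "real j"] by (simp add: W_def order_trans)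
  qed (use that weight_nonpos in \<open>auto simp: W_def\<close>)
  have "W 0 * (z j - \<eta> * z (j - 1))\<^sup>2 + \<mu> * (z j)\<^sup>2 \<le> W 0 * M"
  proof (rule energy_step)
    show "(\<Sum>l\<le>j. W l) = 0"
      using W[of "\<lambda>_. 1"] by (simp add: quad_term_const)
    show "(\<Sum>l\<le>j. W l * z (j - l)) = - \<mu> * z j"
      using eq by (simp only: W)
    show "W 0 > 0" using K nu by (simp add: W0 weight_first)
    show "deflate \<eta> W 1 \<le> - (\<eta>\<^sup>2 * W 0)"
      using eta nu K unfolding d1 W0 eta2 by simp
    have "deflate \<eta> W 1 \<le> 0" using d1 nu K by simp
    thus "deflate \<eta> W l \<le> 0" if "1 \<le> l" "l \<le> j" for l
      by (rule deflate_nonpos[OF eta(1) _ d2 neg that])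
    show "W 0 * (z k - \<eta> * z (k - 1))\<^sup>2 + \<mu> * (z k)\<^sup>2 \<le> W 0 * M" if "1 \<le> k" "k < j" for k
      unfolding W0 by (rule IH[OF that])
    show "2 \<le> j" using j by simp
  qed (fact eta mu z0)+
  thus ?thesis by (simp only: W0)
qed

lemma energy_step_odd:
  fixes z :: "nat \<Rightarrow> real"
  defines "\<eta> \<equiv> 2 * \<nu> / (2 + \<nu>)"
  assumes j: "j = 2 * m + 1" "m \<ge> 1" and mu: "\<mu> \<ge> 0"
    and eq: "(\<Sum>i<m. quad_term \<nu> 2 (real (2 * i + 2))
      (z (j - (2 * i + 2))) (z (j - (2 * i + 1))) (z (j - 2 * i)))
      + quad_term \<nu> 1 (real j) (z 0) (z 1) (z 2) = - \<mu> * z j"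
    and z0: "(z 0)\<^sup>2 \<le> M"
    and IH: "\<And>k. 1 \<le> k \<Longrightarrow> k < j \<Longrightarrow>
      weight \<nu> 0 * (z k - \<eta> * z (k - 1))\<^sup>2 + \<mu> * (z k)\<^sup>2 \<le> weight \<nu> 0 * M"
  shows "weight \<nu> 0 * (z j - \<eta> * z (j - 1))\<^sup>2 + \<mu> * (z j)\<^sup>2 \<le> weight \<nu> 0 * M"
proof -
  \<comment> \<open>The half stencil on [x_0, x_1] uses x_0, x_1, x_2, which lie at the distances j,
    2m and 2m - 1.\<close>
  define W where "W l = (if l = j then kint \<nu> 1 1 (-3 / 2) (real j)
    else if l = 2 * m then kint \<nu> 2 1 (-3 / 2) (real (2 * m)) + kint \<nu> 1 (-2) 2 (real j)
    else if l = 2 * m - 1 then weight \<nu> l + kint \<nu> 1 1 (-1 / 2) (real j) else weight \<nu> l)" for l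
  have W: "(\<Sum>l\<le>j. W l * u l) = (\<Sum>i<m. quad_term \<nu> 2 (real (2 * i + 2))
      (u (2 * i + 2)) (u (2 * i + 1)) (u (2 * i)))
      + quad_term \<nu> 1 (real j) (u j) (u (2 * m)) (u (2 * m - 1))" for u
  proof -
    have "(\<Sum>l<2 * m. W l * u l) = (\<Sum>l<2 * m. weight \<nu> l * u l +
        (if l = 2 * m - 1 then kint \<nu> 1 1 (-1 / 2) (real j) * u (2 * m - 1) else 0))"
      using j by (intro sum.cong) (auto simp: W_def algebra_simps)
    also have "\<dots> = (\<Sum>l<2 * m. weight \<nu> l * u l) + kint \<nu> 1 1 (-1 / 2) (real j) * u (2 * m - 1)"
      using j by (simp add: sum.distrib)
    finally have "(\<Sum>l<2 * m. W l * u l) = \<dots>" .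
    moreover have "(\<Sum>l\<le>j. W l * u l) =
        (\<Sum>l<2 * m. W l * u l) + W (2 * m) * u (2 * m) + W j * u j"
      using j by (simp flip: lessThan_Suc_atMost)
    ultimately show ?thesis
      unfolding sum_quad_term[OF j(2)]
      by (simp add: W_def j quad_term_def algebra_simps)
  qed
  have K: "kunit \<nu> > 0" by (rule kunit_pos[OF nu])
  have eta: "0 \<le> \<eta>" "\<eta> < 1" "\<eta> * (2 + \<nu>) = 2 * \<nu>" "\<eta> \<le> 2 / 3"
    using nu by (auto simp: \<eta>_def field_simps)
  have eW: "\<eta> * weight \<nu> 0 = 2 * \<nu> * kunit \<nu>"
    unfolding weight_first mult.assoc[symmetric] eta(3) ..
  have eta2: "\<eta>\<^sup>2 * weight \<nu> 0 = 2 * \<nu> * \<eta> * kunit \<nu>"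
    using eW by (simp add: power2_eq_square mult.assoc)
  have W0: "W 0 = weight \<nu> 0" using j by (auto simp: W_def)
  have nu2: "\<nu> \<le> 2 * \<eta>" using nu by (simp add: \<eta>_def field_simps)
  have sq: "\<nu> * \<nu> * kunit \<nu> \<le> 2 * \<nu> * \<eta> * kunit \<nu>"
    using mult_left_mono[OF nu2, of "\<nu> * kunit \<nu>"] nu K by (simp add: mult_ac)
  have d1: "deflate \<eta> W 1 = W 1 + 2 * \<nu> * kunit \<nu>"
    using eW W0 by simp
  have first: "deflate \<eta> W 1 \<le> - 2 * \<nu> * \<eta> * kunit \<nu> \<and> deflate \<eta> W 2 \<le> 0"
  \<comment> \<open>For j = 3 the half-stencil terms reach l = 1 and l = 2, so both critical
    coefficients change; for m >= 2 they start at l = 3 or later.\<close>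
  proof (cases "m = 1")
    case True
    hence j3: "j = 3" using j by simp
    let ?b = "(1 - \<nu>) * (2 - \<nu>) * kunit \<nu>"
    have b: "?b \<ge> 0" using nu K by simp
    have r: "kint \<nu> 1 1 (-1 / 2) 3 \<le> \<nu> / 4 * ?b"
      using kint_half_right_le[OF nu, of 2] two_powr_eq_kunit[OF nu] by simp
    have mid: "kint \<nu> 1 (-2) 2 3 \<le> ?b * (1 - 2 / 9 * \<nu>)"
      using kint_half_middle_le[OF nu, of 2] two_powr_eq_kunit[OF nu] by simp
    have W1: "W 1 \<le> -4 * \<nu> * kunit \<nu> + \<nu> / 4 * ?b"
      using r weight_first j3 by (simp add: W_def True)
    have d1': "deflate \<eta> W 1 \<le> - 2 * \<nu> * kunit \<nu> + \<nu> / 4 * ?b"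
      using d1 W1 by simp
    have "- 2 * \<nu> + \<nu> / 4 * ((1 - \<nu>) * (2 - \<nu>)) \<le> - 2 * \<nu> * \<eta>"
    proof -
      have "(1 - \<nu>) * (2 - \<nu>) \<le> (1 - \<nu>) * 2"
        using nu by (intro mult_left_mono) auto
      moreover have "4 * \<eta> \<le> 4 - (1 - \<nu>)"
      proof -
        have "0 \<le> \<nu> * \<nu>" by simp
        hence "\<nu> * 3 \<le> \<nu> * \<nu> + 6" using nu by linarith
        thus ?thesis using nu by (simp add: \<eta>_def field_simps)
      qed
      ultimately have "\<nu> * ((1 - \<nu>) * (2 - \<nu>) / 4) \<le> \<nu> * (2 - 2 * \<eta>)"
        using nu by (intro mult_left_mono) auto
      thus ?thesis by (simp add: algebra_simps add_divide_distrib diff_divide_distrib)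
    qed
    hence "(- 2 * \<nu> + \<nu> / 4 * ((1 - \<nu>) * (2 - \<nu>))) * kunit \<nu> \<le> (- 2 * \<nu> * \<eta>) * kunit \<nu>"
      using K by (intro mult_right_mono) auto
    hence D1: "deflate \<eta> W 1 \<le> - 2 * \<nu> * \<eta> * kunit \<nu>"
      using d1' by (simp add: algebra_simps)
    have "deflate \<eta> W 2 = W 2 + \<eta> * deflate \<eta> W 1"
      by (simp add: numeral_2_eq_2)
    also have "\<eta> * deflate \<eta> W 1 \<le> \<eta> * (- 2 * \<nu> * kunit \<nu>) + \<eta> * (\<nu> / 4 * ?b)"
      unfolding distrib_left[symmetric] by (rule mult_left_mono[OF d1' eta(1)])
    \<comment> \<open>The bound \<eta> <= 2/3 makes this loss \<nu>/6, less than the gain 2\<nu>/9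
      of the middle term in \<open>W 2\<close>; the balance is the \<nu>/18 below.\<close>
    also have "\<eta> * (\<nu> / 4 * ?b) \<le> 2 / 3 * (\<nu> / 4 * ?b)"
      using eta nu b by (intro mult_right_mono) auto
    also have "W 2 \<le> (3 * \<nu> - 2) * kunit \<nu> + ?b * (1 - 2 / 9 * \<nu>)"
      using mid kint_first[OF nu] j3 by (simp add: W_def True)
    finally have "deflate \<eta> W 2 \<le> (3 * \<nu> - 2) * kunit \<nu> + ?b * (1 - \<nu> / 18) - \<eta> * 2 * \<nu> * kunit \<nu>"
      by (simp add: algebra_simps)
    also have "?b * (1 - \<nu> / 18) \<le> ?b * 1"
      using b nu by (intro mult_left_mono) auto
    also have "(3 * \<nu> - 2) * kunit \<nu> + ?b * 1 - \<eta> * 2 * \<nu> * kunit \<nu> =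
        \<nu> * kunit \<nu> * (\<nu> - 2 * \<eta>)"
      by (simp add: algebra_simps)
    also have "\<dots> \<le> 0"
      using nu nu2 K by (intro mult_nonneg_nonpos) auto
    finally show ?thesis using D1 by simp
  next
    case False
    hence m: "m \<ge> 2" using j by simp
    hence W1: "W 1 = -4 * \<nu> * kunit \<nu>" and W2: "W 2 = weight \<nu> 2"
      using j weight_first by (auto simp: W_def)
    have D1: "deflate \<eta> W 1 = - 2 * \<nu> * kunit \<nu>"
      using d1 W1 by simp
    have "deflate \<eta> W 2 = W 2 + \<eta> * deflate \<eta> W 1" by (simp add: numeral_2_eq_2)
    hence "deflate \<eta> W 2 \<le> 0" using D1 W2 weight_2_le sq by (simp add: mult_ac)
    moreover have "deflate \<eta> W 1 \<le> - 2 * \<nu> * \<eta> * kunit \<nu>"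
      using D1 eta nu K by simp
    ultimately show ?thesis by blast
  qed
  have neg: "W l \<le> 0" if l: "3 \<le> l" "l \<le> j" for l
  proof -
    \<comment> \<open>At l = 2m the bound of \<open>kint_left_le\<close> cancels the half-stencil
      middle term; at l = 2m - 1 the gain 4/3 of \<open>kint_middle_le\<close> outweighs the loss
      1/2 of \<open>kint_half_right_le\<close>.\<close>
    consider "l = j" | "l = 2 * m" "m \<ge> 2" | "l = 2 * m - 1" "m \<ge> 2" | "l < 2 * m - 1"
      using l j by linarith
    thus ?thesis
    proof cases
      case 1
      thus ?thesis using kint_half_left_le_0[OF nu, of "real j"] j by (simp add: W_def)
    next
      case 2
      let ?D = "real (2 * m)"
      have D: "?D \<ge> 4" using 2 by simp
      have "kint \<nu> 1 (-2) 2 (?D + 1) \<le> ?D powr (-\<nu>) * 1"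
        using D nu by (intro order_trans[OF kint_half_middle_le[OF nu]] mult_left_mono) auto
      thus ?thesis using 2 D j kint_left_le[OF nu, of ?D] by (simp add: W_def add.commute)
    next
      case 3
      let ?D = "real (2 * m)"
      let ?e = "\<nu> * ?D powr (-\<nu>) / ?D"
      have D: "?D \<ge> 4" using 3 by simp
      have "kint \<nu> 1 1 (-1 / 2) (?D + 1) \<le> ?e / 2"
        using D kint_half_right_le[OF nu, of ?D] by simp
      moreover have "kint \<nu> 2 (-2) 2 ?D \<le> - 4 / 3 * ?e"
      proof -
        have "?e \<le> \<nu> * (?D - 1) powr (-\<nu>) / ?D"
          using D nu by (intro divide_right_mono mult_left_mono powr_mono2') auto
        thus ?thesis using kint_middle_le[OF nu, of ?D] D by simp
      qed
      moreover have "?e \<ge> 0" using nu by simp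
      moreover have "W l = kint \<nu> 2 (-2) 2 ?D + kint \<nu> 1 1 (-1 / 2) (?D + 1)"
      proof -
        have "l \<noteq> j" "l \<noteq> 2 * m" "odd l" "real l + 1 = ?D" "real j = ?D + 1"
          using 3 j by auto
        thus ?thesis using 3 by (simp add: W_def weight_def)
      qed
      moreover have "a \<le> e / 2 \<Longrightarrow> b \<le> - 4 / 3 * e \<Longrightarrow> 0 \<le> e \<Longrightarrow> b + a \<le> 0"
        for a b e :: real by linarith
      ultimately show ?thesis by metis
    next
      case 4
      hence "l \<noteq> j" "l \<noteq> 2 * m" "l \<noteq> 2 * m - 1" using j by linarith+
      hence "W l = weight \<nu> l" by (simp add: W_def)
      thus ?thesis using l weight_nonpos by simp
    qed
  qed
  have "W 0 * (z j - \<eta> * z (j - 1))\<^sup>2 + \<mu> * (z j)\<^sup>2 \<le> W 0 * M"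
  proof (rule energy_step)
    show "(\<Sum>l\<le>j. W l) = 0"
      using W[of "\<lambda>_. 1"] j by (simp add: quad_term_const)
    have "j - 2 * m = 1" "j - (2 * m - 1) = 2" using j by auto
    thus "(\<Sum>l\<le>j. W l * z (j - l)) = - \<mu> * z j"
      using eq W[of "\<lambda>l. z (j - l)"] by simp
    show "W 0 > 0" using K nu by (simp add: W0 weight_first)
    show "deflate \<eta> W 1 \<le> - (\<eta>\<^sup>2 * W 0)"
      using first unfolding W0 eta2 by simp
    have "- 2 * \<nu> * \<eta> * kunit \<nu> \<le> 0" using nu eta K by simp
    hence "deflate \<eta> W 1 \<le> 0" using first by linarith
    thus "deflate \<eta> W l \<le> 0" if "1 \<le> l" "l \<le> j" for l
      by (rule deflate_nonpos[OF eta(1) _ conjunct2[OF first] neg that])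
    show "W 0 * (z k - \<eta> * z (k - 1))\<^sup>2 + \<mu> * (z k)\<^sup>2 \<le> W 0 * M" if "1 \<le> k" "k < j" for k
      unfolding W0 by (rule IH[OF that])
    show "2 \<le> j" using j by simp
  qed (fact eta mu z0)+
  thus ?thesis by (simp only: W0)
qed

end

section \<open>The two coupled starting equations\<close>

text \<open>Eliminating x2 gives x1 = \<rho> * x0 with an explicit rational \<rho>, which reduces
  the claim to a scalar quadratic inequality in \<rho>.\<close>

lemma first_step:
  fixes \<nu> \<mu> x0 x1 x2 :: real
  assumes nu: "0 < \<nu>" "\<nu> < 1" and mu: "\<mu> \<ge> 0"
    and eq1: "quad_term \<nu> 1 1 x0 x1 x2 = - \<mu> * x1"
    and eq2: "quad_term \<nu> 2 2 x0 x1 x2 = - \<mu> * x2"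
  shows "weight \<nu> 0 * (x1 - 2 * \<nu> / (2 + \<nu>) * x0)\<^sup>2 + \<mu> * x1\<^sup>2 \<le> weight \<nu> 0 * x0\<^sup>2"
proof -
  define K where "K = kunit \<nu>"
  define s where "s = \<mu> / K"
  define b where "b = 2 * 2 powr (-\<nu>)"
  define \<eta> where "\<eta> = 2 * \<nu> / (2 + \<nu>)"
  have K: "K > 0" unfolding K_def by (rule kunit_pos[OF nu])
  have s: "s \<ge> 0" "\<mu> = s * K" using K mu by (auto simp: s_def)
  have b1: "b \<ge> 1"
    using powr_mono[of "-1" "-\<nu>" "2 :: real"] nu by (simp add: b_def powr_minus_divide)
  have eta: "(2 + \<nu>) * \<eta> = 2 * \<nu>" "0 \<le> \<eta>" "\<eta> < 1" using nu by (auto simp: \<eta>_def)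

  define B where "B = (1 - \<nu>) * (2 - \<nu>)"
  have B: "B > 0" "2 powr (-\<nu>) = B * K"
    using nu two_powr_eq_kunit[OF nu] by (auto simp: B_def K_def)
  have "2 * B * quad_term \<nu> 1 1 x0 x1 x2 = - (4 - 3 * \<nu>) * x0 + 4 * (1 - \<nu>) * x1 + \<nu> * x2"
  proof -
    have "1 - \<nu> \<noteq> 0" "2 - \<nu> \<noteq> 0" using nu by auto
    hence "B / (1 - \<nu>) = 2 - \<nu>" "B / (2 - \<nu>) = 1 - \<nu>" by (simp_all add: B_def)
    moreover have "B * kint \<nu> 1 p q 1 = (p + q) * (B / (1 - \<nu>)) - p * (B / (2 - \<nu>))" for p q
      unfolding kint_half[OF nu] by (simp add: algebra_simps)
    ultimately have k: "B * kint \<nu> 1 p q 1 = (p + q) * (2 - \<nu>) - p * (1 - \<nu>)" for p q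
      by simp
    have "2 * B * quad_term \<nu> 1 1 x0 x1 x2 = 2 * (B * kint \<nu> 1 1 (-3 / 2) 1) * x0
        + 2 * (B * kint \<nu> 1 (-2) 2 1) * x1 + 2 * (B * kint \<nu> 1 1 (-1 / 2) 1) * x2"
      by (simp add: quad_term_def algebra_simps)
    thus ?thesis unfolding k by (simp add: algebra_simps add_divide_distrib diff_divide_distrib)
  qed
  moreover have "2 * B * (- \<mu> * x1) = - b * s * x1"
    by (simp add: b_def s(2) B(2))
  ultimately have e1: "- (4 - 3 * \<nu>) * x0 + 4 * (1 - \<nu>) * x1 + \<nu> * x2 = - b * s * x1"
    using eq1 by simp
  have "K * ((3 * \<nu> - 2) * x0 - 4 * \<nu> * x1 + (2 + \<nu>) * x2) = K * (- s * x2)"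
    using eq2 unfolding quad_term_def kint_first[OF nu] K_def[symmetric] s(2)
    by (simp add: algebra_simps)
  hence e2: "(3 * \<nu> - 2) * x0 - 4 * \<nu> * x1 + (2 + \<nu>) * x2 = - s * x2"
    using K by (simp only: mult_cancel_left) auto

  define P where "P = 8 - 4 * \<nu> + (4 - 3 * \<nu>) * s"
  \<comment> \<open>\<open>P + X\<close> is what \<open>Den\<close> becomes for b = 1. As b >= 1,
    this is the worst case, and it removes the power of 2 from the estimate.\<close>
  define X where "X = s * (2 + s)"
  define Den where "Den = 8 - 4 * \<nu> + 4 * (1 - \<nu>) * s + b * s * (2 + \<nu> + s)"
  have P: "P > 0" and X: "X \<ge> 0" using nu s by (auto simp: P_def X_def add_pos_nonneg)
  have "1 * (s * (2 + \<nu> + s)) \<le> b * (s * (2 + \<nu> + s))"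
    using b1 s nu by (intro mult_right_mono) auto
  hence Den: "P + X \<le> Den" by (simp add: P_def X_def Den_def algebra_simps)
  have "Den * x1 = P * x0"
  proof -
    \<comment> \<open>Elimination of x2: (2 + \<nu> + s) times the first equation minus \<nu> times
      the second.\<close>
    have "Den * x1 - P * x0 = (2 + \<nu> + s) *
        (- (4 - 3 * \<nu>) * x0 + 4 * (1 - \<nu>) * x1 + \<nu> * x2 + b * s * x1)
        - \<nu> * ((3 * \<nu> - 2) * x0 - 4 * \<nu> * x1 + (2 + \<nu>) * x2 + s * x2)"
      unfolding Den_def P_def by (simp add: algebra_simps)
    thus ?thesis using e1 e2 by simp
  qed
  define \<rho> where "\<rho> = P / Den"
  define \<sigma> where "\<sigma> = P / (P + X)"
  have x1: "x1 = \<rho> * x0"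
    using \<open>Den * x1 = P * x0\<close> P X Den by (simp add: \<rho>_def field_simps)
  have rho: "0 \<le> \<rho>" "\<rho> \<le> \<sigma>"
    using P X Den by (auto simp: \<rho>_def \<sigma>_def intro!: divide_left_mono)

  \<comment> \<open>The quadratic inequality for \<sigma> with denominators cleared, arranged by
    powers of \<open>P\<close> and \<open>X\<close> so that every term is nonnegative.\<close>
  have "0 \<le> 8 * \<nu> * P\<^sup>2 + s * P * ((2 + s) * (8 + 16 * \<nu> - 2 * \<nu>\<^sup>2) - (2 + \<nu>) * P)
      + (2 - \<nu>) * (2 + 3 * \<nu>) * X\<^sup>2"
  proof -
    have "P \<le> (2 + s) * (4 - 2 * \<nu>)"
      using nu s by (simp add: P_def algebra_simps)
    hence "(2 + \<nu>) * P \<le> (2 + \<nu>) * ((2 + s) * (4 - 2 * \<nu>))"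
      using nu by (intro mult_left_mono) auto
    also have "\<dots> = (2 + s) * (8 - 2 * \<nu>\<^sup>2)"
      by (simp add: algebra_simps power2_eq_square)
    also have "\<dots> \<le> (2 + s) * (8 + 16 * \<nu> - 2 * \<nu>\<^sup>2)"
      using nu s by (intro mult_left_mono) auto
    finally show ?thesis using nu s P by simp
  qed
  also have "\<dots> = (2 - \<nu>) * (2 + 3 * \<nu>) * (P + X)\<^sup>2
      - (2 + \<nu>) * ((2 + \<nu> + s) * P\<^sup>2 - 4 * \<nu> * (P * (P + X)))"
    by (simp add: X_def algebra_simps power2_eq_square)
  finally have "(2 + \<nu>) * ((2 + \<nu> + s) * P\<^sup>2 - 4 * \<nu> * (P * (P + X))) / (P + X)\<^sup>2 \<le>
      (2 - \<nu>) * (2 + 3 * \<nu>)"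
    using P X by (subst pos_divide_le_eq) auto
  moreover have "(2 + \<nu>) * ((2 + \<nu> + s) * P\<^sup>2 - 4 * \<nu> * (P * (P + X))) / (P + X)\<^sup>2 =
      (2 + \<nu>) * (\<sigma> * ((2 + \<nu> + s) * \<sigma> - 4 * \<nu>))"
    using P X by (simp add: \<sigma>_def field_simps power2_eq_square)
  moreover have "(2 - \<nu>) * (2 + 3 * \<nu>) = (2 + \<nu>) * ((2 + \<nu>) - 2 * \<nu> * \<eta>)"
  proof -
    have "(2 + \<nu>) * ((2 + \<nu>) - 2 * \<nu> * \<eta>) = (2 + \<nu>) * (2 + \<nu>) - 2 * \<nu> * ((2 + \<nu>) * \<eta>)"
      by (simp add: algebra_simps)
    thus ?thesis unfolding eta(1) by (simp add: algebra_simps)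
  qed
  ultimately have sigma: "\<sigma> * ((2 + \<nu> + s) * \<sigma> - 4 * \<nu>) \<le> (2 + \<nu>) - 2 * \<nu> * \<eta>"
    using nu by simp
  have "\<rho> * ((2 + \<nu> + s) * \<rho> - 4 * \<nu>) \<le> (2 + \<nu>) - 2 * \<nu> * \<eta>"
  \<comment> \<open>Where the second factor is positive the product increases with \<rho>, so \<rho>
    may be replaced by \<sigma>; otherwise it is at most 0.\<close>
  proof (cases "(2 + \<nu> + s) * \<rho> \<le> 4 * \<nu>")
    case True
    have "\<nu> * \<eta> \<le> 1 * 1" using nu eta by (intro mult_mono) auto
    moreover have "\<rho> * ((2 + \<nu> + s) * \<rho> - 4 * \<nu>) \<le> 0"
      using True rho by (intro mult_nonneg_nonpos) auto
    ultimately show ?thesis using nu by simp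
  next
    case False
    hence "\<rho> * ((2 + \<nu> + s) * \<rho> - 4 * \<nu>) \<le> \<sigma> * ((2 + \<nu> + s) * \<sigma> - 4 * \<nu>)"
      using rho nu s by (intro mult_mono diff_right_mono mult_left_mono) auto
    thus ?thesis using sigma by linarith
  qed
  moreover have "(2 + \<nu>) * (\<rho> - \<eta>)\<^sup>2 + s * \<rho>\<^sup>2 =
      (2 + \<nu> + s) * \<rho>\<^sup>2 - 2 * \<rho> * ((2 + \<nu>) * \<eta>) + \<eta> * ((2 + \<nu>) * \<eta>)"
    by (simp add: algebra_simps power2_eq_square)
  ultimately have "(2 + \<nu>) * (\<rho> - \<eta>)\<^sup>2 + s * \<rho>\<^sup>2 \<le> 2 + \<nu>"
    unfolding eta(1) by (simp add: algebra_simps power2_eq_square)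
  hence "((2 + \<nu>) * (\<rho> - \<eta>)\<^sup>2 + s * \<rho>\<^sup>2) * (K * x0\<^sup>2) \<le> (2 + \<nu>) * (K * x0\<^sup>2)"
    using K by (intro mult_right_mono) auto
  moreover have "(x1 - \<eta> * x0)\<^sup>2 = (\<rho> - \<eta>)\<^sup>2 * x0\<^sup>2" "x1\<^sup>2 = \<rho>\<^sup>2 * x0\<^sup>2"
    by (simp_all add: x1 power_mult_distrib flip: left_diff_distrib)
  ultimately show ?thesis
    unfolding weight_first[OF nu] K_def[symmetric] \<eta>_def[symmetric]
    by (simp add: s(2) algebra_simps)
qed

section \<open>The discrete Caputo derivative as a sum over stencils\<close>

lemma poly_pderiv_interp:
  assumes "h > 0"
  shows "poly (pderiv (interp h z i)) s =
    ((s / h - real i - 3 / 2) * z i + (2 - 2 * (s / h - real i)) * z (i + 1)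
      + (s / h - real i - 1 / 2) * z (i + 2)) / h"
proof -
  define a where "a = grid h i"
  have g: "grid h i = a" "grid h (i + 1) = a + h" "grid h (i + 2) = a + 2 * h"
    by (simp_all add: a_def grid_def algebra_simps)
  define d where "d = (z (i + 1) - z i) / h"
  define e where "e = (z (i + 2) - 2 * z (i + 1) + z i) / (2 * h ^ 2)"
  define p where "p = [:z i - d * a + e * a * (a + h), d - e * (2 * a + h), e:]"
  have p: "poly p x = z i + d * (x - a) + e * (x - a) * (x - (a + h))" for x
    by (simp add: p_def algebra_simps)
  have e: "e * h * h = (z (i + 2) - 2 * z (i + 1) + z i) / 2" "d * h = z (i + 1) - z i"
    using assms by (simp_all add: e_def d_def power2_eq_square)
  have "poly p a = z i" "poly p (a + h) = z (i + 1)"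
    using e by (simp_all add: p)
  moreover have "poly p (a + 2 * h) = z i + 2 * (d * h) + 2 * (e * h * h)"
    by (simp add: p algebra_simps)
  hence "poly p (a + 2 * h) = z (i + 2)"
    using e by (simp add: field_simps)
  moreover have "degree p \<le> 2"
    by (simp add: p_def)
  ultimately have "interp h z i = p"
    unfolding interp_def using interp_ex1[OF assms, of i z] g
    by (intro the1_equality) auto
  moreover define t where "t = s / h - real i"
  hence "s = a + h * t"
    using assms by (simp add: a_def grid_def field_simps)
  hence "poly (pderiv p) s * h = d * h + e * h * h * (2 * t - 1)"
    by (simp add: p_def pderiv_pCons algebra_simps)
  ultimately show ?thesis
    using assms unfolding e t_def[symmetric] by (simp add: field_simps)
qed

text \<open>The substitution r = s / h - i: the factor h from ds cancels the 1 / h of the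
  derivative, leaving the power of h from the kernel. The length b is free so that b = 1 covers the
  half stencil.\<close>

lemma has_integral_piece:
  fixes h b \<nu> :: real
  assumes nu: "0 < \<nu>" "\<nu> < 1" and h: "h > 0" and b: "0 \<le> b" "real i + b \<le> real j"
    and start: "\<And>s. grid h i < s \<Longrightarrow> s < grid h i + b * h \<Longrightarrow> piece_start h j s = i"
  shows "((\<lambda>s. deriv (pw_quad h j z) s * omega \<nu> (grid h j - s)) has_integral
    h powr (-\<nu>) / Gamma (1 - \<nu>) * quad_term \<nu> b (real j - real i) (z i) (z (i + 1)) (z (i + 2)))
    {grid h i .. grid h i + b * h}"
proof -
  let ?D = "real j - real i"
  let ?C = "h powr (-\<nu>) / Gamma (1 - \<nu>)"
  let ?f = "\<lambda>r. (1 * r + -3 / 2) * (?D - r) powr (-\<nu>) * z i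
      + ((-2) * r + 2) * (?D - r) powr (-\<nu>) * z (i + 1)
      + (1 * r + -1 / 2) * (?D - r) powr (-\<nu>) * z (i + 2)"
  have "(?f has_integral quad_term \<nu> b ?D (z i) (z (i + 1)) (z (i + 2))) {0..b}"
    unfolding quad_term_def using b
    by (intro has_integral_add has_integral_mult_left has_integral_kint[OF nu]) auto
  hence "(?f has_integral quad_term \<nu> b ?D (z i) (z (i + 1)) (z (i + 2))) (cbox 0 b)"
    by simp
  from has_integral_affinity'[OF this, of "1 / h" "- real i"]
  have "((\<lambda>s. ?f (s / h - real i)) has_integral
      h * quad_term \<nu> b ?D (z i) (z (i + 1)) (z (i + 2))) {grid h i .. grid h i + b * h}"
    using h by (simp add: grid_def algebra_simps)
  from has_integral_mult_right[OF this, of "?C / h"]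
  have int: "((\<lambda>s. ?C / h * ?f (s / h - real i)) has_integral
      ?C * quad_term \<nu> b ?D (z i) (z (i + 1)) (z (i + 2))) {grid h i .. grid h i + b * h}"
    using h by simp
  show ?thesis
  \<comment> \<open>At the two ends the interpolant may switch stencils, so its \<open>deriv\<close>
    is controlled only in between.\<close>
  proof (rule has_integral_spike_finite[OF _ _ int, of "{grid h i, grid h i + b * h}"])
    fix s assume "s \<in> {grid h i .. grid h i + b * h} - {grid h i, grid h i + b * h}"
    hence s: "s \<in> {grid h i <..< grid h i + b * h}" by auto
    have "\<forall>\<^sub>F t in nhds s. t \<in> {grid h i <..< grid h i + b * h}"
      using s by (intro eventually_nhds_in_open) auto
    hence "\<forall>\<^sub>F t in nhds s. pw_quad h j z t = poly (interp h z i) t"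
      by eventually_elim (use start in \<open>auto simp: pw_quad_def\<close>)
    hence "deriv (pw_quad h j z) s = deriv (poly (interp h z i)) s"
      by (intro deriv_cong_ev) auto
    also have "\<dots> = poly (pderiv (interp h z i)) s"
      by (intro DERIV_imp_deriv poly_DERIV)
    finally have d: "deriv (pw_quad h j z) s = poly (pderiv (interp h z i)) s" .
    have r: "s / h - real i < b" "grid h j - s = h * (?D - (s / h - real i))"
      using s h by (auto simp: grid_def field_simps)
    have "omega \<nu> (grid h j - s) = ?C * (?D - (s / h - real i)) powr (-\<nu>)"
      unfolding omega_def r(2) using h r(1) b by (subst powr_mult) auto
    thus "deriv (pw_quad h j z) s * omega \<nu> (grid h j - s) = ?C / h * ?f (s / h - real i)"
      unfolding d poly_pderiv_interp[OF h] by (simp add: algebra_simps add_divide_distrib diff_divide_distrib)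
  qed auto
qed

lemma discrete_caputo_even:
  fixes h \<nu> :: real
  assumes nu: "0 < \<nu>" "\<nu> < 1" and h: "h > 0" and j: "j = 2 * m" "m \<ge> 1"
  shows "discrete_caputo \<nu> h z j = h powr (-\<nu>) / Gamma (1 - \<nu>) *
    (\<Sum>i<m. quad_term \<nu> 2 (real (2 * i + 2))
      (z (j - (2 * i + 2))) (z (j - (2 * i + 1))) (z (j - 2 * i)))"
proof -
  let ?F = "\<lambda>s. deriv (pw_quad h j z) s * omega \<nu> (grid h j - s)"
  let ?C = "h powr (-\<nu>) / Gamma (1 - \<nu>)"
  let ?q = "\<lambda>k. quad_term \<nu> 2 (real j - real (2 * k)) (z (2 * k)) (z (2 * k + 1)) (z (2 * k + 2))"
  have g: "grid h (2 * k) + 2 * h = grid h (2 * k + 2)" for k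
    by (simp add: grid_def algebra_simps)
  have "(?F has_integral ?C * (\<Sum>k<n. ?q k)) {0..grid h (2 * n)}" if "n \<le> m" for n
    using that
  proof (induction n)
    case 0
    show ?case by (simp add: grid_def has_integral_refl)
  next
    case (Suc n)
    have "piece_start h j s = 2 * n" if "grid h (2 * n) < s" "s < grid h (2 * n) + 2 * h" for s
    proof (cases "j > 2")
      case True
      thus ?thesis using that h j unfolding g by (intro piece_start_even) auto
    next
      case False
      thus ?thesis using Suc.prems j by (simp add: piece_start_def)
    qed
    hence "(?F has_integral ?C * ?q n) {grid h (2 * n)..grid h (2 * n) + 2 * h}"
      using Suc.prems j by (intro has_integral_piece nu h) auto
    from has_integral_combine[OF _ _ Suc.IH this] show ?case
      using Suc.prems h unfolding g by (simp add: grid_def distrib_left)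
  qed
  from this[of m] have "discrete_caputo \<nu> h z j = ?C * (\<Sum>k<m. ?q k)"
    unfolding discrete_caputo_def j by (intro integral_unique) auto
  \<comment> \<open>Reversing the order lists the stencils by distance from x_j, as the weights
    require.\<close>
  also have "(\<Sum>k<m. ?q k) = (\<Sum>i<m. ?q (m - Suc i))"
    by (rule sum.nat_diff_reindex[symmetric])
  also have "\<dots> = (\<Sum>i<m. quad_term \<nu> 2 (real (2 * i + 2))
      (z (j - (2 * i + 2))) (z (j - (2 * i + 1))) (z (j - 2 * i)))"
  proof (rule sum.cong)
    fix i assume "i \<in> {..<m}"
    hence i: "2 * (m - Suc i) = j - (2 * i + 2)" "2 * i + 2 \<le> j" using j by auto
    have "j - (2 * i + 2) + 1 = j - (2 * i + 1)" "j - (2 * i + 2) + 2 = j - 2 * i"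
      "real j - real (j - (2 * i + 2)) = real (2 * i + 2)"
      using i by auto
    thus "?q (m - Suc i) = quad_term \<nu> 2 (real (2 * i + 2))
      (z (j - (2 * i + 2))) (z (j - (2 * i + 1))) (z (j - 2 * i))"
      unfolding i(1) by simp
  qed simp
  finally show ?thesis .
qed

text \<open>Includes m = 0: at j = 1 only the half stencil remains, which brings in the later value
  \<open>z 2\<close>.\<close>

lemma discrete_caputo_odd:
  fixes h \<nu> :: real
  assumes nu: "0 < \<nu>" "\<nu> < 1" and h: "h > 0" and j: "j = 2 * m + 1"
  shows "discrete_caputo \<nu> h z j = h powr (-\<nu>) / Gamma (1 - \<nu>) *
    ((\<Sum>i<m. quad_term \<nu> 2 (real (2 * i + 2))
      (z (j - (2 * i + 2))) (z (j - (2 * i + 1))) (z (j - 2 * i)))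
     + quad_term \<nu> 1 (real j) (z 0) (z 1) (z 2))"
proof -
  let ?F = "\<lambda>s. deriv (pw_quad h j z) s * omega \<nu> (grid h j - s)"
  let ?C = "h powr (-\<nu>) / Gamma (1 - \<nu>)"
  let ?q = "\<lambda>k. quad_term \<nu> 2 (real j - real (2 * k + 1))
    (z (2 * k + 1)) (z (2 * k + 2)) (z (2 * k + 3))"
  let ?first = "quad_term \<nu> 1 (real j) (z 0) (z 1) (z 2)"
  have g: "grid h (2 * k + 1) + 2 * h = grid h (2 * k + 3)" for k
    by (simp add: grid_def algebra_simps)
  have "(?F has_integral ?C * ((\<Sum>k<n. ?q k) + ?first)) {0..grid h (2 * n + 1)}" if "n \<le> m" for n
    using that
  proof (induction n)
    case 0
    have "piece_start h j s = 0" if "grid h 0 < s" "s < grid h 0 + 1 * h" for s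
      using that by (auto simp: piece_start_def grid_def j)
    hence "(?F has_integral ?C * quad_term \<nu> 1 (real j - real 0) (z 0) (z (0 + 1)) (z (0 + 2)))
        {grid h 0..grid h 0 + 1 * h}"
      using j by (intro has_integral_piece nu h) auto
    hence "(?F has_integral ?C * ?first) {grid h 0..grid h 0 + 1 * h}"
      by (simp only: add_0 of_nat_0 diff_zero)
    thus ?case by (simp add: grid_def)
  next
    case (Suc n)
    have "piece_start h j s = 2 * n + 1"
      if "grid h (2 * n + 1) < s" "s < grid h (2 * n + 1) + 2 * h" for s
      using that h j Suc.prems piece_start_odd[of h j "Suc n" s] unfolding g by (simp add: numeral_3_eq_3)
    hence "(?F has_integral ?C * quad_term \<nu> 2 (real j - real (2 * n + 1))
        (z (2 * n + 1)) (z (2 * n + 1 + 1)) (z (2 * n + 1 + 2)))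
        {grid h (2 * n + 1)..grid h (2 * n + 1) + 2 * h}"
      using Suc.prems j by (intro has_integral_piece nu h) auto
    hence "(?F has_integral ?C * ?q n) {grid h (2 * n + 1)..grid h (2 * n + 3)}"
      by (simp only: g) (simp add: numeral_3_eq_3)
    from has_integral_combine[OF _ _ Suc.IH this]
    have "(?F has_integral ?C * ((\<Sum>k<n. ?q k) + ?first) + ?C * ?q n) {0..grid h (2 * n + 3)}"
      using Suc.prems h by (simp add: grid_def)
    thus ?case by (simp add: algebra_simps numeral_3_eq_3)
  qed
  from this[of m] have "discrete_caputo \<nu> h z j = ?C * ((\<Sum>k<m. ?q k) + ?first)"
    unfolding discrete_caputo_def j by (intro integral_unique) auto
  also have "(\<Sum>k<m. ?q k) = (\<Sum>i<m. ?q (m - Suc i))"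
    by (rule sum.nat_diff_reindex[symmetric])
  also have "\<dots> = (\<Sum>i<m. quad_term \<nu> 2 (real (2 * i + 2))
      (z (j - (2 * i + 2))) (z (j - (2 * i + 1))) (z (j - 2 * i)))"
  proof (rule sum.cong)
    fix i assume "i \<in> {..<m}"
    hence "2 * (m - Suc i) + 1 = j - (2 * i + 2)" "2 * (m - Suc i) + 2 = j - (2 * i + 1)"
      "2 * (m - Suc i) + 3 = j - 2 * i" "real j - real (j - (2 * i + 2)) = real (2 * i + 2)"
      using j by auto
    thus "?q (m - Suc i) = quad_term \<nu> 2 (real (2 * i + 2))
      (z (j - (2 * i + 2))) (z (j - (2 * i + 1))) (z (j - 2 * i))"
      by simp
  qed simp
  finally show ?thesis .
qed

section \<open>The stability bound\<close>

theorem theorem3p4: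
  fixes \<nu> T lam y0 :: real and N :: nat and y :: "nat \<Rightarrow> real"
  assumes "0 < \<nu>" "\<nu> < 1" "T > 0" "lam > 0" "N > 0"
    and "y 0 = y0"
    and "\<forall>j\<in>{1..2 * N}. discrete_caputo \<nu> (T / (2 * real N)) y j = - lam * y j"
  shows "\<forall>k\<in>{1..2 * N}. \<bar>y k\<bar> \<le> (2 + \<nu>) / (2 - \<nu>) * \<bar>y0\<bar>"
proof -
  note nu = assms(1,2)
  define h where "h = T / (2 * real N)"
  define C where "C = h powr (-\<nu>) / Gamma (1 - \<nu>)"
  define \<mu> where "\<mu> = lam / C"
  define \<eta> where "\<eta> = 2 * \<nu> / (2 + \<nu>)"
  have h: "h > 0" using assms by (simp add: h_def)
  have C: "C > 0" using h nu by (simp add: C_def Gamma_real_pos)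
  have mu: "\<mu> \<ge> 0" using C assms(4) by (simp add: \<mu>_def)
  have W0: "weight \<nu> 0 > 0" using nu kunit_pos[OF nu] by (simp add: weight_first)
  have scaled: "S = - \<mu> * y j"
    if "discrete_caputo \<nu> h y j = C * S" "1 \<le> j" "j \<le> 2 * N" for S j
    using assms(7) that C by (auto simp: \<mu>_def h_def field_simps)
  have even: "(\<Sum>i<m. quad_term \<nu> 2 (real (2 * i + 2))
      (y (j - (2 * i + 2))) (y (j - (2 * i + 1))) (y (j - 2 * i))) = - \<mu> * y j"
    if "j = 2 * m" "m \<ge> 1" "j \<le> 2 * N" for j m
    using that discrete_caputo_even[OF nu h that(1,2)]
    by (intro scaled) (auto simp: C_def)
  have odd: "(\<Sum>i<m. quad_term \<nu> 2 (real (2 * i + 2))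
      (y (j - (2 * i + 2))) (y (j - (2 * i + 1))) (y (j - 2 * i)))
      + quad_term \<nu> 1 (real j) (y 0) (y 1) (y 2) = - \<mu> * y j"
    if "j = 2 * m + 1" "j \<le> 2 * N" for j m
    using that discrete_caputo_odd[OF nu h that(1)]
    by (intro scaled) (auto simp: C_def)
  have energy: "weight \<nu> 0 * (y k - \<eta> * y (k - 1))\<^sup>2 + \<mu> * (y k)\<^sup>2 \<le> weight \<nu> 0 * y0\<^sup>2"
    if "1 \<le> k" "k \<le> 2 * N" for k
    using that
  proof (induction k rule: less_induct)
    case (less k)
    have z0: "(y 0)\<^sup>2 \<le> y0\<^sup>2" by (simp add: assms(6))
    consider "k = 1" | m where "k = 2 * m" "m \<ge> 1" | m where "k = 2 * m + 1" "m \<ge> 1"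
    proof (cases "even k")
      case True
      then obtain m where "k = 2 * m" by blast
      thus thesis using that(2)[of m] less.prems by simp
    next
      case False
      then obtain m where "k = 2 * m + 1" using oddE by blast
      thus thesis using that(1) that(3)[of m] by (cases "m = 0") auto
    qed
    thus ?case
    proof cases
      case 1
      have "weight \<nu> 0 * (y 1 - 2 * \<nu> / (2 + \<nu>) * y 0)\<^sup>2 + \<mu> * (y 1)\<^sup>2 \<le> weight \<nu> 0 * (y 0)\<^sup>2"
      \<comment> \<open>Both starting equations are available because N > 0 puts x_2 on the
        grid.\<close>
      proof (rule first_step[OF nu mu])
        show "quad_term \<nu> 1 1 (y 0) (y 1) (y 2) = - \<mu> * y 1"
          using odd[of 1 0] assms(5) by simp
        show "quad_term \<nu> 2 2 (y 0) (y 1) (y 2) = - \<mu> * y 2"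
          using even[of 2 1] assms(5) by simp
      qed
      thus ?thesis by (simp add: 1 \<eta>_def assms(6))
    next
      case (2 m)
      show ?thesis
        unfolding \<eta>_def
      proof (rule energy_step_even[OF nu 2 mu even[OF 2 less.prems(2)] z0])
        show "weight \<nu> 0 * (y i - 2 * \<nu> / (2 + \<nu>) * y (i - 1))\<^sup>2 + \<mu> * (y i)\<^sup>2 \<le> weight \<nu> 0 * y0\<^sup>2"
          if "1 \<le> i" "i < k" for i
          using less.IH[of i] that less.prems(2) unfolding \<eta>_def by linarith
      qed
    next
      case (3 m)
      show ?thesis
        unfolding \<eta>_def
      proof (rule energy_step_odd[OF nu 3 mu odd[OF 3(1) less.prems(2)] z0])
        show "weight \<nu> 0 * (y i - 2 * \<nu> / (2 + \<nu>) * y (i - 1))\<^sup>2 + \<mu> * (y i)\<^sup>2 \<le> weight \<nu> 0 * y0\<^sup>2"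
          if "1 \<le> i" "i < k" for i
          using less.IH[of i] that less.prems(2) unfolding \<eta>_def by linarith
      qed
    qed
  qed
  have diff: "\<bar>y k - \<eta> * y (k - 1)\<bar> \<le> \<bar>y0\<bar>" if "1 \<le> k" "k \<le> 2 * N" for k
  proof -
    have "\<mu> * (y k)\<^sup>2 \<ge> 0" using mu by simp
    hence "weight \<nu> 0 * (y k - \<eta> * y (k - 1))\<^sup>2 \<le> weight \<nu> 0 * y0\<^sup>2"
      using energy[OF that] by linarith
    thus ?thesis using W0 by (simp add: abs_le_square_iff)
  qed
  \<comment> \<open>c is the fixed point of x to 1 + \<eta> * x, so the induction closes with the
    same constant at every index.\<close>
  define c where "c = (2 + \<nu>) / (2 - \<nu>)"
  have eta: "\<eta> \<ge> 0" using nu by (simp add: \<eta>_def)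
  have "\<eta> * c = 2 * \<nu> / (2 - \<nu>)" using nu by (simp add: c_def \<eta>_def)
  hence c: "1 + \<eta> * c = c" "c \<ge> 1"
    using nu by (auto simp: c_def field_simps)
  have "\<bar>y k\<bar> \<le> c * \<bar>y0\<bar>" if "k \<le> 2 * N" for k
    using that
  proof (induction k)
    case 0
    show ?case using c(2) mult_right_mono[of 1 c "\<bar>y0\<bar>"] by (simp add: assms(6))
  next
    case (Suc k)
    have "\<bar>y (Suc k)\<bar> \<le> \<bar>y (Suc k) - \<eta> * y k\<bar> + \<eta> * \<bar>y k\<bar>"
      using eta abs_triangle_ineq[of "y (Suc k) - \<eta> * y k" "\<eta> * y k"] by (simp add: abs_mult)
    also have "\<dots> \<le> \<bar>y0\<bar> + \<eta> * (c * \<bar>y0\<bar>)"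
      using Suc diff[of "Suc k"] eta by (intro add_mono mult_left_mono) auto
    also have "\<dots> = (1 + \<eta> * c) * \<bar>y0\<bar>" by (simp add: algebra_simps)
    finally show ?case by (simp add: c(1))
  qed
  thus ?thesis by (simp add: c_def)
qed

end
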